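(* Let $N\in\mathbb{N}$ be fixed and let $\mathcal{F}$ be a nonempty collection of $k$-colourings of $E(K_N)$. For any $\varepsilon>0$ there exist constants $C_0,n_0>0$, depending only on $(\varepsilon,k,N)$, such that for any $n\ge n_0$ there exists a collection $\mathcal{T}$ of $k$-colouring templates for $K_n$ satisfying: (i) $\mathcal{T}$ is a container family for $\mathrm{Forb}(\mathcal{F})_n$; (ii) for each template $t\in\mathcal{T}$, there are at most $\varepsilon\binom{n}{N}$ $N$-element sets $A\subseteq[n]$ such that $c\le t_{|A}$ for some $c\in\mathcal{F}$; (iii) $\log_k|\mathcal{T}|\le C_0\, n^{-1/(2\binom{N}{2}-1)}\binom{n}{2}$.
   Context: $k\ge2$ is a fixed integer and $[k]=\{1,\dots,k\}$. $K_n$ is the complete graph on vertex set $[n]$. A $k$-colouring of $K_n$ (or of $E(K_n)$) is a function $c:E(K_n)\to[k]$. For $A=\{a_1<\dots<a_m\}\subseteq[n]$ the restriction $c_{|A}$ is the $k$-colouring of $K_m$ given by $c_{|A}(ij)=c(a_ia_j)$. A ($k$-colouring) template for $K_n$ is a function $t$ assigning to each edge $e\in E(K_n)$ a nonempty set $t(e)\subseteq[k]$; its restriction $t_{|A}$ is the template for $K_m$ with $t_{|A}(ij)=t(a_ia_j)$. A realisation of $t$ is a $k$-colouring $c$ of $K_n$ with $c(e)\in t(e)$ for all $e$; $\langle t\rangle$ is the set of realisations. For a $k$-colouring $c$ of $K_N$ and an $N$-set $A\subseteq[n]$, $c\le t_{|A}$ means $c(e)\in t_{|A}(e)$ for every $e\in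 E(K_N)$. $\mathrm{Forb}(\mathcal{F})_n$ is the set of $k$-colourings $c$ of $K_n$ such that $c_{|A}\notin\mathcal{F}$ for every $N$-set $A\subseteq[n]$. A container family for a set $\mathcal{G}$ of $k$-colourings of $K_n$ is a collection $\mathcal{T}$ of templates for $K_n$ with $\mathcal{G}\subseteq\bigcup_{t\in\mathcal{T}}\langle t\rangle$. Convention: $\log_k 0=-\infty$. *)

theory Defs
  imports
    Complex_Main
    "HOL-Library.FuncSet"
    "HOL-Library.Ramsey"
    "HOL-Library.Extended_Real"
begin

text \<open>
  The edge \<open>ij\<close> of \<open>K_n\<close> is the set \<open>{i, j}\<close>, so the edge set is \<open>nsets {1..n} 2\<close>.
  Colourings and templates are extensional functions on it, so that equality and cardinality
  of sets of them do not see values outside the edge set.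
\<close>

abbreviation edges :: "nat \<Rightarrow> nat set set" where
  "edges n \<equiv> nsets {1..n} 2"

definition colourings :: "nat \<Rightarrow> nat \<Rightarrow> (nat set \<Rightarrow> nat) set" where
  "colourings k n = edges n \<rightarrow>\<^sub>E {1..k}"

definition templates :: "nat \<Rightarrow> nat \<Rightarrow> (nat set \<Rightarrow> nat set) set" where
  "templates k n = edges n \<rightarrow>\<^sub>E (Pow {1..k} - {{}})"

text \<open>
  For a finite set \<open>A = {a_1 < ... < a_m}\<close>, \<open>elem A i\<close> is \<open>a_i\<close> (positions start at \<open>1\<close>, list
  indices at \<open>0\<close>). The restriction is polymorphic: it applies to colourings and to templates.
\<close>

definition elem :: "nat set \<Rightarrow> nat \<Rightarrow> nat" where
  "elem A i = sorted_list_of_set A ! (i - 1)"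

definition restr :: "(nat set \<Rightarrow> 'b) \<Rightarrow> nat set \<Rightarrow> nat set \<Rightarrow> 'b" where
  "restr c A = (\<lambda>e\<in>edges (card A). c (elem A ` e))"

text \<open>The relation \<open>c \<le> t\<close> on \<open>K_m\<close>.\<close>

definition below :: "nat \<Rightarrow> (nat set \<Rightarrow> nat) \<Rightarrow> (nat set \<Rightarrow> nat set) \<Rightarrow> bool" where
  "below m c t \<longleftrightarrow> (\<forall>e\<in>edges m. c e \<in> t e)"

definition realisations :: "nat \<Rightarrow> nat \<Rightarrow> (nat set \<Rightarrow> nat set) \<Rightarrow> (nat set \<Rightarrow> nat) set" where
  "realisations k n t = {c \<in> colourings k n. below n c t}"

definition Forb :: "nat \<Rightarrow> nat \<Rightarrow> (nat set \<Rightarrow> nat) set \<Rightarrow> nat \<Rightarrow> (nat set \<Rightarrow> nat) set" where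
  "Forb k N \<F> n = {c \<in> colourings k n. \<forall>A\<in>nsets {1..n} N. restr c A \<notin> \<F>}"

definition container_family ::
  "nat \<Rightarrow> nat \<Rightarrow> (nat set \<Rightarrow> nat set) set \<Rightarrow> (nat set \<Rightarrow> nat) set \<Rightarrow> bool" where
  "container_family k n \<T> \<G> \<longleftrightarrow> \<T> \<subseteq> templates k n \<and> \<G> \<subseteq> (\<Union>t\<in>\<T>. realisations k n t)"

text \<open>
  The logarithm of a natural number with \<open>log_k 0 = -\<infinity>\<close>, in contrast to the real
  \<^const>\<open>log\<close>, which yields \<open>0\<close> at \<open>0\<close>.
\<close>

definition elog :: "nat \<Rightarrow> nat \<Rightarrow> ereal" where
  "elog k m = (if m = 0 then -\<infinity> else ereal (log (real k) (real m)))"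

end

theory Submission
  imports Defs "HOL-Library.Indicator_Function"
begin

text \<open>
  Encode a colouring \<open>c\<close> as the set of pairs \<open>(e, c e)\<close>. The colourings in \<open>Forb\<close> are then
  independent sets of the hypergraph whose edges are the coloured copies of members of \<open>\<F>\<close>, and
  the templates come from containers for independent sets. Containers are built by induction on
  the uniformity. Given an independent set \<open>I\<close>, ask repeatedly whether a vertex \<open>x\<close> of large
  degree lies in \<open>I\<close>. If not, delete \<open>x\<close>; if so, add its link to a hypergraph of uniformity one
  less, in which \<open>I\<close> is again independent. Hyperedges through a vertex or a pair whose degree in
  the collected link hypergraph has become large are ignored from then on; this keeps its degrees
  balanced at the cost of few hyperedges. Either many vertices get deleted, or after \<open>q\<close> positive
  answers the link hypergraph is dense and the induction applies to it. The answers form a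
  decision tree with at most \<open>(|V| + 1)^q\<close> leaves, so no fingerprints have to be decoded.
  For coloured copies the codegrees are smaller than the degrees by a factor \<open>n\<close>, so that
  \<open>q\<close> of order \<open>n^(-1/r) n^2\<close> suffices, where \<open>r\<close> is \<open>N choose 2\<close>. Since \<open>1/r > 1/(2r-1)\<close> for
  \<open>r > 1\<close>, this absorbs the logarithm of \<open>|V|\<close>; for \<open>r = 1\<close> a single container is enough.
\<close>

section \<open>Weighted hypergraphs and containers\<close>

definition deg :: "'a set \<Rightarrow> ('a set \<Rightarrow> real) \<Rightarrow> 'a set \<Rightarrow> real" where
  "deg A w Y = (\<Sum>S | S \<subseteq> A \<and> Y \<subseteq> S. w S)"

text \<open>Weights rather than sets of hyperedges, because a sum of links counts a hyperedge with
  multiplicity. Only subsets of \<open>A\<close> are constrained, so the same \<open>w\<close>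
  serves every induced subhypergraph.\<close>

definition uniform_on :: "'a set \<Rightarrow> nat \<Rightarrow> ('a set \<Rightarrow> real) \<Rightarrow> bool" where
  "uniform_on A r w \<longleftrightarrow> (\<forall>S\<subseteq>A. 0 \<le> w S \<and> (w S \<noteq> 0 \<longrightarrow> card S = r))"

definition degrees_le :: "'a set \<Rightarrow> ('a set \<Rightarrow> real) \<Rightarrow> real \<Rightarrow> real \<Rightarrow> bool" where
  "degrees_le A w d1 d2 \<longleftrightarrow> (\<forall>u\<in>A. deg A w {u} \<le> d1) \<and> (\<forall>p\<in>nsets A 2. deg A w p \<le> d2)"

definition edge_free :: "('a set \<Rightarrow> real) \<Rightarrow> 'a set \<Rightarrow> bool" where
  "edge_free w I \<longleftrightarrow> (\<forall>S\<subseteq>I. w S = 0)"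

text \<open>\<open>P\<close> selects the sets to be covered, \<open>Q\<close> is the property guaranteed for each container.\<close>

definition has_containers ::
  "'a set \<Rightarrow> ('a set \<Rightarrow> bool) \<Rightarrow> ('a set \<Rightarrow> bool) \<Rightarrow> nat \<Rightarrow> bool" where
  "has_containers A P Q B \<longleftrightarrow> (\<exists>\<C>. finite \<C> \<and> card \<C> \<le> B \<and> (\<forall>C\<in>\<C>. C \<subseteq> A \<and> Q C) \<and>
     (\<forall>I\<subseteq>A. P I \<longrightarrow> (\<exists>C\<in>\<C>. I \<subseteq> C)))"

section \<open>Combining container families\<close>

lemma has_containers_mono:
  assumes "has_containers A P Q B" "B \<le> B'" "\<And>I. I \<subseteq> A \<Longrightarrow> P' I \<Longrightarrow> P I"
    "\<And>C. C \<subseteq> A \<Longrightarrow> Q C \<Longrightarrow> Q' C"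
  shows "has_containers A P' Q' B'"
proof -
  obtain \<C> where C: "finite \<C>" "card \<C> \<le> B" "\<forall>C\<in>\<C>. C \<subseteq> A \<and> Q C"
    "\<forall>I\<subseteq>A. P I \<longrightarrow> (\<exists>C\<in>\<C>. I \<subseteq> C)"
    using assms(1) unfolding has_containers_def by blast
  have "card \<C> \<le> B'"
    using C(2) assms(2) by simp
  moreover have "\<forall>C\<in>\<C>. C \<subseteq> A \<and> Q' C"
    using C(3) assms(4) by blast
  moreover have "\<forall>I\<subseteq>A. P' I \<longrightarrow> (\<exists>C\<in>\<C>. I \<subseteq> C)"
    using C(4) assms(3) by blast
  ultimately show ?thesis
    unfolding has_containers_def using C(1) by blast
qed

lemma has_containers_single:
  assumes "C \<subseteq> A" "Q C" "\<And>I. I \<subseteq> A \<Longrightarrow> P I \<Longrightarrow> I \<subseteq> C" "B \<ge> 1"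
  shows "has_containers A P Q B"
  unfolding has_containers_def using assms by (intro exI[of _ "{C}"]) auto

text \<open>One branching of the decision tree: the two families are united and their bounds add
  up.\<close>

lemma has_containers_split:
  assumes "has_containers A P\<^sub>1 Q B\<^sub>1" "has_containers A P\<^sub>2 Q B\<^sub>2"
    "\<And>I. I \<subseteq> A \<Longrightarrow> P I \<Longrightarrow> P\<^sub>1 I \<or> P\<^sub>2 I" "B\<^sub>1 + B\<^sub>2 \<le> B"
  shows "has_containers A P Q B"
proof -
  obtain \<C> where C: "finite \<C>" "card \<C> \<le> B\<^sub>1" "\<forall>C\<in>\<C>. C \<subseteq> A \<and> Q C"
    "\<forall>I\<subseteq>A. P\<^sub>1 I \<longrightarrow> (\<exists>C\<in>\<C>. I \<subseteq> C)"
    using assms(1) unfolding has_containers_def by blast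
  obtain \<D> where D: "finite \<D>" "card \<D> \<le> B\<^sub>2" "\<forall>C\<in>\<D>. C \<subseteq> A \<and> Q C"
    "\<forall>I\<subseteq>A. P\<^sub>2 I \<longrightarrow> (\<exists>C\<in>\<D>. I \<subseteq> C)"
    using assms(2) unfolding has_containers_def by blast
  have "card (\<C> \<union> \<D>) \<le> B"
    using card_Un_le[of \<C> \<D>] C D assms(4) by linarith
  moreover have "\<forall>I\<subseteq>A. P I \<longrightarrow> (\<exists>C\<in>\<C> \<union> \<D>. I \<subseteq> C)"
    using assms(3) C(4) D(4) by (meson UnCI)
  moreover have "finite (\<C> \<union> \<D>)" "\<forall>C\<in>\<C> \<union> \<D>. C \<subseteq> A \<and> Q C"
    using C D by blast+
  ultimately show ?thesis
    unfolding has_containers_def by blast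
qed

text \<open>One round of refinement: each container is replaced by containers of its own. The sets
  to be covered can be passed on because \<open>P\<close> does not refer to the ground set.\<close>

lemma has_containers_bind:
  assumes "has_containers A P Q B"
    "\<And>C. C \<subseteq> A \<Longrightarrow> Q C \<Longrightarrow> has_containers C P Q' B'"
  shows "has_containers A P Q' (B * B')"
proof -
  obtain \<C> where C: "finite \<C>" "card \<C> \<le> B" "\<forall>C\<in>\<C>. C \<subseteq> A \<and> Q C"
    "\<forall>I\<subseteq>A. P I \<longrightarrow> (\<exists>C\<in>\<C>. I \<subseteq> C)"
    using assms(1) unfolding has_containers_def by blast
  have "\<exists>f. \<forall>C\<in>\<C>. finite (f C) \<and> card (f C) \<le> B' \<and> (\<forall>C'\<in>f C. C' \<subseteq> C \<and> Q' C') \<and>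
     (\<forall>I\<subseteq>C. P I \<longrightarrow> (\<exists>C'\<in>f C. I \<subseteq> C'))"
    using assms(2) C(3) unfolding has_containers_def by (intro bchoice) simp
  then obtain f where "\<forall>C\<in>\<C>. finite (f C) \<and> card (f C) \<le> B' \<and> (\<forall>C'\<in>f C. C' \<subseteq> C \<and> Q' C') \<and>
     (\<forall>I\<subseteq>C. P I \<longrightarrow> (\<exists>C'\<in>f C. I \<subseteq> C'))" ..
  note f = bspec[OF this]
  have "card (\<Union>C\<in>\<C>. f C) \<le> (\<Sum>C\<in>\<C>. card (f C))"
    by (rule card_UN_le[OF C(1)])
  also have "\<dots> \<le> card \<C> * B'"
    using sum_bounded_above[of \<C> "\<lambda>C. card (f C)" B'] f by simp
  also have "\<dots> \<le> B * B'"
    using C(2) by simp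
  finally have "card (\<Union>C\<in>\<C>. f C) \<le> B * B'" .
  moreover have "finite (\<Union>C\<in>\<C>. f C)"
    using C(1) f by simp
  moreover have "\<forall>C'\<in>(\<Union>C\<in>\<C>. f C). C' \<subseteq> A \<and> Q' C'"
  proof
    fix C' assume "C' \<in> (\<Union>C\<in>\<C>. f C)"
    then obtain C where "C \<in> \<C>" "C' \<in> f C"
      by auto
    then show "C' \<subseteq> A \<and> Q' C'"
      using C(3) f[of C] by (meson subset_trans)
  qed
  moreover have "\<forall>I\<subseteq>A. P I \<longrightarrow> (\<exists>C'\<in>(\<Union>C\<in>\<C>. f C). I \<subseteq> C')"
  proof (intro allI impI)
    fix I assume I: "I \<subseteq> A" "P I"
    then obtain C where "C \<in> \<C>" "I \<subseteq> C"
      using C(4) by auto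
    moreover from this obtain C' where "C' \<in> f C" "I \<subseteq> C'"
      using f I(2) by meson
    ultimately show "\<exists>C'\<in>(\<Union>C\<in>\<C>. f C). I \<subseteq> C'"
      by auto
  qed
  ultimately show ?thesis
    unfolding has_containers_def by blast
qed

section \<open>Degree sums and discarded hyperedges\<close>

lemma deg_eq_sum_Pow:
  assumes "finite A"
  shows "deg A w p = (\<Sum>S\<in>Pow A. if p \<subseteq> S then w S else 0)"
proof -
  have "{S. S \<subseteq> A \<and> p \<subseteq> S} = {S \<in> Pow A. p \<subseteq> S}"
    by auto
  then have "deg A w p = sum w {S \<in> Pow A. p \<subseteq> S}"
    unfolding deg_def by simp
  also have "\<dots> = (\<Sum>S\<in>Pow A. if p \<subseteq> S then w S else 0)"
    using assms by (intro sum.inter_filter) simp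
  finally show ?thesis .
qed

lemma deg_mono:
  assumes "finite A" "uniform_on A r w" "C \<subseteq> A" "Y' \<subseteq> Y"
  shows "deg C w Y \<le> deg A w Y'"
  unfolding deg_def using assms by (intro sum_mono2) (auto simp: uniform_on_def)

text \<open>Double counting: a hyperedge of size \<open>r\<close> contains \<open>r choose j\<close>
  sets of size \<open>j\<close>.\<close>

lemma sum_deg_nsets:
  assumes A: "finite A" and w: "uniform_on A r w"
  shows "(\<Sum>p\<in>nsets A j. deg A w p) = real (r choose j) * deg A w {}"
proof -
  have fin: "finite (nsets A j)"
    using A by (rule finite_imp_finite_nsets)
  have "(\<Sum>p\<in>nsets A j. deg A w p) = (\<Sum>p\<in>nsets A j. \<Sum>S\<in>Pow A. if p \<subseteq> S then w S else 0)"
    using A by (simp add: deg_eq_sum_Pow)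
  also have "\<dots> = (\<Sum>S\<in>Pow A. \<Sum>p\<in>nsets A j. if p \<subseteq> S then w S else 0)"
    by (rule sum.swap)
  also have "\<dots> = (\<Sum>S\<in>Pow A. real (r choose j) * w S)"
  proof (intro sum.cong refl)
    fix S assume S: "S \<in> Pow A"
    have "(\<Sum>p\<in>nsets A j. if p \<subseteq> S then w S else 0) = (\<Sum>p\<in>{p\<in>nsets A j. p \<subseteq> S}. w S)"
      by (rule sum.inter_filter[symmetric, OF fin])
    also have "{p\<in>nsets A j. p \<subseteq> S} = nsets S j"
      using S unfolding nsets_def by auto
    finally have *: "(\<Sum>p\<in>nsets A j. if p \<subseteq> S then w S else 0) = real (card S choose j) * w S"
      using S A by (simp add: card_nsets finite_subset)
    show "(\<Sum>p\<in>nsets A j. if p \<subseteq> S then w S else 0) = real (r choose j) * w S"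
      using * S w by (cases "w S = 0") (auto simp: uniform_on_def)
  qed
  also have "\<dots> = real (r choose j) * deg A w {}"
    by (simp add: deg_def sum_distrib_left Pow_def)
  finally show ?thesis .
qed

lemma sum_deg_vertices:
  assumes "finite A" "uniform_on A r w"
  shows "(\<Sum>u\<in>A. deg A w {u}) = real r * deg A w {}"
proof -
  have "nsets A 1 = (\<lambda>u. {u}) ` A"
    by (auto simp: nsets_def card_1_singleton_iff)
  then show ?thesis
    using sum_deg_nsets[OF assms, of 1] by (simp add: sum.reindex)
qed

definition avoiding :: "'a set set \<Rightarrow> ('a set \<Rightarrow> real) \<Rightarrow> 'a set \<Rightarrow> real" where
  "avoiding X w S = (if \<exists>p\<in>X. p \<subseteq> S then 0 else w S)"

lemma uniform_avoiding: "uniform_on A r w \<Longrightarrow> uniform_on A r (avoiding X w)"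
  by (auto simp: uniform_on_def avoiding_def)

lemma deg_avoiding_le: "uniform_on A r w \<Longrightarrow> deg A (avoiding X w) Y \<le> deg A w Y"
  unfolding deg_def avoiding_def uniform_on_def by (intro sum_mono) auto

lemma deg_avoiding_eq_0:
  assumes "p \<in> X" "p \<subseteq> Y"
  shows "deg A (avoiding X w) Y = 0"
proof -
  have "avoiding X w S = 0" if "Y \<subseteq> S" for S
    using assms that unfolding avoiding_def by (meson subset_trans)
  then show ?thesis
    unfolding deg_def by (intro sum.neutral) simp
qed

text \<open>Union bound: a discarded hyperedge contains some \<open>p\<close> in \<open>X\<close>
  and is counted in the degree of that \<open>p\<close>.\<close>

lemma deg_le_deg_avoiding:
  assumes A: "finite A" and X: "finite X" and w: "uniform_on A r w"
  shows "deg A w {} \<le> deg A (avoiding X w) {} + (\<Sum>p\<in>X. deg A w p)"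
proof -
  have "deg A w {} = (\<Sum>S\<in>Pow A. w S)"
    by (simp add: deg_def Pow_def)
  also have "\<dots> \<le> (\<Sum>S\<in>Pow A. avoiding X w S + (\<Sum>p\<in>X. if p \<subseteq> S then w S else 0))"
  proof (intro sum_mono)
    fix S assume S: "S \<in> Pow A"
    then have pos: "w S \<ge> 0"
      using w by (auto simp: uniform_on_def)
    show "w S \<le> avoiding X w S + (\<Sum>p\<in>X. if p \<subseteq> S then w S else 0)"
    proof (cases "\<exists>p\<in>X. p \<subseteq> S")
      case True
      then obtain p where "p \<in> X" "p \<subseteq> S"
        by blast
      then have "w S \<le> (\<Sum>p\<in>X. if p \<subseteq> S then w S else 0)"
        using member_le_sum[of p X "\<lambda>p. if p \<subseteq> S then w S else 0"] X pos by auto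
      then show ?thesis
        using True by (simp add: avoiding_def)
    next
      case False
      then have "(\<Sum>p\<in>X. if p \<subseteq> S then w S else 0) = 0"
        by (intro sum.neutral) auto
      with False show ?thesis
        by (simp add: avoiding_def)
    qed
  qed
  also have "\<dots> = deg A (avoiding X w) {} + (\<Sum>p\<in>X. deg A w p)"
    by (simp add: deg_eq_sum_Pow[OF A] sum.distrib sum.swap[of _ "Pow A" X])
  finally show ?thesis .
qed

text \<open>Averaging over at most \<open>v\<close> vertices, whose degrees sum to \<open>r\<close>
  times the total weight.\<close>

lemma exists_heavy_vertex:
  assumes A: "finite A" "real (card A) \<le> v" and w: "uniform_on A r w" and r: "r \<ge> 1"
    and v: "v > 0" and \<gamma>: "\<gamma> > 0" "\<gamma> * v \<le> deg A w {}"
  shows "\<exists>x\<in>A. \<gamma> \<le> deg A w {x}"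
proof (rule ccontr)
  assume "\<not> ?thesis"
  then have small: "deg A w {x} < \<gamma>" if "x \<in> A" for x
    using that by force
  have ne: "A \<noteq> {}"
  proof
    assume "A = {}"
    then have "real r * deg A w {} = 0"
      using sum_deg_vertices[OF A(1) w] by simp
    then show False
      using r v \<gamma> by (smt (verit) mult_pos_pos mult_eq_0_iff of_nat_0_eq_iff not_one_le_zero)
  qed
  have "real r * deg A w {} = (\<Sum>u\<in>A. deg A w {u})"
    using sum_deg_vertices[OF A(1) w] by simp
  also have "\<dots> < (\<Sum>u\<in>A. \<gamma>)"
    using small ne A by (intro sum_strict_mono) auto
  also have "\<dots> \<le> \<gamma> * v"
    using A \<gamma> by (simp add: mult.commute)
  finally have "real r * deg A w {} < \<gamma> * v" .
  moreover have "deg A w {} \<le> real r * deg A w {}"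
    using mult_right_mono[of 1 "real r" "deg A w {}"] r \<gamma> v
    by (smt (verit) mult_pos_pos of_nat_1 of_nat_le_iff mult_1)
  ultimately show False
    using \<gamma> by linarith
qed

section \<open>Link hypergraphs\<close>

text \<open>Sets that contain \<open>x\<close> must get weight 0: for them
  \<open>insert x S = S\<close>, and a hyperedge of full size would slip into the link.\<close>

definition link :: "'a \<Rightarrow> ('a set \<Rightarrow> real) \<Rightarrow> 'a set \<Rightarrow> real" where
  "link x w S = (if x \<in> S then 0 else w (insert x S))"

lemma uniform_link:
  assumes "finite A" "uniform_on A (Suc s) w" "x \<in> A"
  shows "uniform_on A s (link x w)"
  unfolding uniform_on_def
proof (intro allI impI)
  fix S assume S: "S \<subseteq> A"
  then have "finite S"
    using assms(1) finite_subset by blast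
  moreover have "0 \<le> w (insert x S) \<and> (w (insert x S) \<noteq> 0 \<longrightarrow> card (insert x S) = Suc s)"
    using assms S unfolding uniform_on_def by (metis insert_subset)
  ultimately show "0 \<le> link x w S \<and> (link x w S \<noteq> 0 \<longrightarrow> card S = s)"
    unfolding link_def by auto
qed

lemma deg_link:
  assumes "finite A" "x \<in> A" "x \<notin> Y"
  shows "deg A (link x w) Y = deg A w (insert x Y)"
proof -
  have "deg A w (insert x Y) = (\<Sum>S | S \<subseteq> A \<and> Y \<subseteq> S \<and> x \<notin> S. w (insert x S))"
    unfolding deg_def using assms
    by (intro sum.reindex_bij_witness[of _ "insert x" "\<lambda>S. S - {x}"]) (auto simp: insert_absorb)
  also have "\<dots> = (\<Sum>S | S \<subseteq> A \<and> Y \<subseteq> S \<and> x \<notin> S. link x w S)"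
    by (intro sum.cong) (auto simp: link_def)
  also have "\<dots> = deg A (link x w) Y"
    unfolding deg_def using assms
    by (intro sum.mono_neutral_left) (auto simp: link_def)
  finally show ?thesis
    by simp
qed

lemma deg_link_in:
  assumes "x \<in> Y"
  shows "deg A (link x w) Y = 0"
  unfolding deg_def using assms by (intro sum.neutral) (auto simp: link_def)

lemma deg_add: "deg A (\<lambda>S. w S + w' S) Y = deg A w Y + deg A w' Y"
  by (simp add: deg_def sum.distrib)

lemma uniform_add:
  assumes "uniform_on A r w" "uniform_on A r w'"
  shows "uniform_on A r (\<lambda>S. w S + w' S)"
  unfolding uniform_on_def
proof (intro allI impI)
  fix S assume "S \<subseteq> A"
  then have "0 \<le> w S \<and> (w S \<noteq> 0 \<longrightarrow> card S = r)" "0 \<le> w' S \<and> (w' S \<noteq> 0 \<longrightarrow> card S = r)"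
    using assms by (auto simp: uniform_on_def)
  then show "0 \<le> w S + w' S \<and> (w S + w' S \<noteq> 0 \<longrightarrow> card S = r)"
    by auto
qed

section \<open>Saturation and the decision tree\<close>

text \<open>Markov's inequality for the degrees of sets of size \<open>j\<close>.\<close>

lemma card_heavy_le:
  assumes "finite A" "uniform_on A r w" "X \<subseteq> nsets A j" "\<And>p. p \<in> X \<Longrightarrow> d \<le> deg A w p"
  shows "real (card X) * d \<le> real (r choose j) * deg A w {}"
proof -
  have "real (card X) * d \<le> (\<Sum>p\<in>X. deg A w p)"
    using sum_bounded_below[of X d "deg A w"] assms(4) by simp
  also have "\<dots> \<le> (\<Sum>p\<in>nsets A j. deg A w p)"
  proof (intro sum_mono2 finite_imp_finite_nsets assms)
    show "0 \<le> deg A w p" for p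
      using assms(2) unfolding deg_def uniform_on_def by (intro sum_nonneg) auto
  qed
  also have "\<dots> = real (r choose j) * deg A w {}"
    by (rule sum_deg_nsets[OF assms(1,2)])
  finally show ?thesis .
qed

text \<open>
  Here \<open>w'\<close> is the link hypergraph collected so far, \<open>R\<close> the set of deleted vertices, and \<open>U\<close>
  and \<open>P\<close> are the vertices and pairs saturated by \<open>w'\<close>.
\<close>

lemma blocked_weight_le:
  assumes A: "finite A" and w: "uniform_on A (Suc s) w" and w': "uniform_on A s w'"
    and dw: "degrees_le A w D (\<rho> * D)"
    and pos: "0 < v" "0 < D" "0 < \<tau>" "0 < K" "0 < \<alpha>"
    and q: "deg A w' {} \<le> 2 * \<tau> * v * D"
    and sat: "16 * real (Suc s) \<le> K * \<alpha>" "16 * (real (Suc s))\<^sup>2 * \<tau> \<le> \<alpha>" "\<beta> \<le> \<alpha> / 8"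
    and R: "R \<subseteq> A" "real (card R) \<le> \<beta> * v"
    and U: "U = {u \<in> A. K * \<tau> * D \<le> deg A w' {u}}"
    and P: "P = {p \<in> nsets A 2. \<rho> * D \<le> deg A w' p}"
  shows "(\<Sum>p\<in>(\<lambda>u. {u}) ` (R \<union> U) \<union> P. deg A w p) \<le> \<alpha> / 2 * v * D"
proof -
  have fin: "finite R" "finite U" "finite P"
    using A R finite_subset finite_imp_finite_nsets[OF A] unfolding U P by auto
  have nonneg: "0 \<le> deg A w p" for p
    using w unfolding deg_def uniform_on_def by (intro sum_nonneg) auto
  \<comment> \<open>Each of the three sources \<open>R\<close>, \<open>U\<close> and
    \<open>P\<close> costs at most one eighth of \<alpha> v D.\<close>
  have "(\<Sum>u\<in>R. deg A w {u}) \<le> real (card R) * D"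
    using dw R(1) by (intro sum_bounded_above) (auto simp: degrees_le_def)
  also have "\<dots> \<le> \<alpha> / 8 * v * D"
    using order_trans[OF R(2) mult_right_mono[OF sat(3)]] pos by (intro mult_right_mono) auto
  finally have 1: "(\<Sum>u\<in>R. deg A w {u}) \<le> \<alpha> / 8 * v * D" .
  \<comment> \<open>Markov bounds the number of saturated vertices by 2 s v / K, and
    \<open>K\<close> is large enough to make this at most \<alpha> v / 8.\<close>
  have "real (card U) * (K * \<tau> * D) = real (card ((\<lambda>u. {u}) ` U)) * (K * \<tau> * D)"
    by (simp add: card_image)
  also have "\<dots> \<le> real (s choose 1) * deg A w' {}"
    using U by (intro card_heavy_le[OF A w']) (auto simp: nsets_def)
  also have "\<dots> \<le> real s * (2 * \<tau> * v * D)"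
    using q by (simp add: mult_left_mono)
  finally have "(\<tau> * D) * (real (card U) * K) \<le> (\<tau> * D) * (2 * real s * v)"
    by (simp add: algebra_simps)
  then have "real (card U) * K \<le> 2 * real s * v"
    using pos by (simp add: mult_le_cancel_left_pos)
  then have "real (card U) * (K * \<alpha>) \<le> 2 * real s * v * \<alpha>"
    using mult_right_mono[of _ _ \<alpha>] pos by (fastforce simp: mult.assoc)
  moreover have "real (card U) * (16 * real (Suc s)) \<le> real (card U) * (K * \<alpha>)"
    using sat(1) by (intro mult_left_mono) auto
  moreover have "2 * real s * v * \<alpha> \<le> 2 * real (Suc s) * v * \<alpha>"
    using pos by (intro mult_right_mono) auto
  ultimately have "(2 * real (Suc s)) * (8 * real (card U)) \<le> (2 * real (Suc s)) * (v * \<alpha>)"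
    by (simp only: ac_simps)
  then have cU: "real (card U) \<le> \<alpha> / 8 * v"
    by (subst (asm) mult_le_cancel_left_pos) (auto simp: mult.commute)
  have "(\<Sum>u\<in>U. deg A w {u}) \<le> real (card U) * D"
    using dw U by (intro sum_bounded_above) (auto simp: degrees_le_def)
  also have "\<dots> \<le> \<alpha> / 8 * v * D"
    using cU pos by (intro mult_right_mono) auto
  finally have 2: "(\<Sum>u\<in>U. deg A w {u}) \<le> \<alpha> / 8 * v * D" .
  \<comment> \<open>The threshold \<rho> D for saturation in \<open>w'\<close> equals the bound on
    pair degrees in \<open>w\<close>, so the loss is at most a sum of pair degrees of
    \<open>w'\<close>.\<close>
  have "(\<Sum>p\<in>P. deg A w p) \<le> real (card P) * (\<rho> * D)"
    using dw P by (intro sum_bounded_above) (auto simp: degrees_le_def)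
  also have "\<dots> \<le> real (s choose 2) * deg A w' {}"
    using P by (intro card_heavy_le[OF A w']) auto
  also have "\<dots> \<le> real (s choose 2) * (2 * \<tau> * v * D)"
    using q by (intro mult_left_mono) auto
  also have "\<dots> \<le> (real (Suc s))\<^sup>2 * (2 * \<tau> * v * D)"
  proof (intro mult_right_mono)
    have "s choose 2 \<le> (Suc s)\<^sup>2"
      using binomial_le_pow[of 2 s] by (cases "2 \<le> s") (auto simp: power2_eq_square binomial_eq_0 intro: order_trans)
    then show "real (s choose 2) \<le> (real (Suc s))\<^sup>2"
      by (metis of_nat_le_iff of_nat_power)
  qed (use pos in auto)
  also have "\<dots> = (16 * (real (Suc s))\<^sup>2 * \<tau>) * (v * D / 8)"
    by simp
  also have "\<dots> \<le> \<alpha> * (v * D / 8)"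
    using sat(2) pos by (intro mult_right_mono) auto
  finally have 3: "(\<Sum>p\<in>P. deg A w p) \<le> \<alpha> / 8 * v * D"
    by simp
  have "(\<Sum>p\<in>(\<lambda>u. {u}) ` (R \<union> U) \<union> P. deg A w p)
      \<le> (\<Sum>p\<in>(\<lambda>u. {u}) ` (R \<union> U). deg A w p) + (\<Sum>p\<in>P. deg A w p)"
    using fin nonneg by (subst sum_Un) (auto intro!: sum_nonneg)
  also have "(\<Sum>p\<in>(\<lambda>u. {u}) ` (R \<union> U). deg A w p) = (\<Sum>u\<in>R \<union> U. deg A w {u})"
    by (simp add: sum.reindex)
  also have "\<dots> \<le> (\<Sum>u\<in>R. deg A w {u}) + (\<Sum>u\<in>U. deg A w {u})"
    using fin nonneg by (subst sum_Un) (auto intro!: sum_nonneg)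
  finally have "(\<Sum>p\<in>(\<lambda>u. {u}) ` (R \<union> U) \<union> P. deg A w p) \<le> 3 * (\<alpha> / 8 * v * D)"
    using 1 2 3 by linarith
  also have "\<dots> \<le> 4 * (\<alpha> / 8 * v * D)"
    using pos by (intro mult_right_mono) auto
  finally show ?thesis
    by (simp add: mult.commute mult.left_commute)
qed

text \<open>
  A node of the decision tree: \<open>R\<close> is the set of deleted vertices, \<open>w'\<close> the sum of the links
  collected so far, and \<open>j\<close> the number of positive answers still allowed.
\<close>

lemma container_process:
  fixes w :: "'a set \<Rightarrow> real"
  assumes A: "finite A" "real (card A) \<le> v" and w: "uniform_on A (Suc s) w"
    and dw: "degrees_le A w D (\<rho> * D)" and tot: "\<alpha> * v * D \<le> deg A w {}"
    and pos: "0 < v" "0 < D" "0 < \<tau>" "0 < K" "0 < \<alpha>" "0 < \<rho>"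
    and q: "real q \<le> 2 * \<tau> * v"
    and sat: "16 * real (Suc s) \<le> K * \<alpha>" "16 * (real (Suc s))\<^sup>2 * \<tau> \<le> \<alpha>" "\<beta> \<le> \<alpha> / 8"
    and B: "1 \<le> B"
    and Q: "\<And>C. C \<subseteq> A \<Longrightarrow> real (card C) \<le> real (card A) - \<beta> * v \<Longrightarrow> Q C"
    and link_containers: "\<And>w'. uniform_on A s w' \<Longrightarrow>
      degrees_le A w' (K * \<tau> * D + \<rho> * D) (2 * \<rho> * D) \<Longrightarrow>
      real q * (\<alpha> / 2 * D) \<le> deg A w' {} \<Longrightarrow> has_containers A (edge_free w') Q B"
    and R: "R \<subseteq> A" and j: "j \<le> q"
    and w': "uniform_on A s w'" "degrees_le A w' (K * \<tau> * D + \<rho> * D) (2 * \<rho> * D)"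
      "deg A w' {} \<le> real (q - j) * D" "real (q - j) * (\<alpha> / 2 * D) \<le> deg A w' {}"
  shows "has_containers A (\<lambda>I. I \<inter> R = {} \<and> edge_free w I \<and> edge_free w' I) Q
    ((card (A - R) + 1) ^ j * B)"
  using R j w'
\<comment> \<open>A negative answer shrinks \<open>A - R\<close> and keeps \<open>j\<close>; a
  positive one keeps \<open>R\<close> and lowers \<open>j\<close>.\<close>
proof (induction "card (A - R) + j" arbitrary: R j w' rule: less_induct)
  case less
  note R = less.prems(1) and j = less.prems(2) and w' = less.prems(3-6)
  have finR: "finite R"
    using R A finite_subset by blast
  consider "\<beta> * v \<le> real (card R)" | "real (card R) < \<beta> * v" "j = 0"
    | "real (card R) < \<beta> * v" "j > 0"
    by linarith
  then show ?case
  proof cases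
    \<comment> \<open>Enough vertices are deleted: \<open>A - R\<close> covers every set disjoint
      from \<open>R\<close>.\<close>
    case 1
    have "card (A - R) = card A - card R"
      using card_Diff_subset[OF finR R] .
    then have "real (card (A - R)) \<le> real (card A) - \<beta> * v"
      using 1 card_mono[OF A(1) R] by (simp add: of_nat_diff)
    then have "Q (A - R)"
      by (intro Q) auto
    then show ?thesis
      using B by (intro has_containers_single[of "A - R"]) auto
  next
    \<comment> \<open>All \<open>q\<close> positive answers are used up, so the invariant makes
      \<open>w'\<close> as heavy as \<open>link_containers\<close> requires.\<close>
    case 2
    then have "has_containers A (edge_free w') Q B"
      using w' by (intro link_containers) auto
    then show ?thesis
      using 2 by (elim has_containers_mono) auto
  next
    case 3
    define U where "U = {u \<in> A. K * \<tau> * D \<le> deg A w' {u}}"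
    define P where "P = {p \<in> nsets A 2. \<rho> * D \<le> deg A w' p}"
    define X where "X = (\<lambda>u. {u}) ` (R \<union> U) \<union> P"
    define g where "g = avoiding X w"
    have finX: "finite X"
      using finR A finite_imp_finite_nsets[OF A(1)] unfolding X_def U_def P_def by auto
    have "real (q - j) * D \<le> 2 * \<tau> * v * D"
      using q pos by (intro mult_right_mono) auto
    then have "deg A w' {} \<le> 2 * \<tau> * v * D"
      using w'(3) by linarith
    then have "(\<Sum>p\<in>X. deg A w p) \<le> \<alpha> / 2 * v * D"
      unfolding X_def
      by (intro blocked_weight_le[OF A(1) w w'(1) dw pos(1-5) _ sat R less_imp_le[OF 3(1)] U_def P_def])
    \<comment> \<open>Half of the guaranteed weight survives, so some vertex has degree at least
      \<alpha> D / 2 in \<open>g\<close>; this is the vertex to ask about.\<close>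
    then have "\<alpha> / 2 * D * v \<le> deg A g {}"
      using deg_le_deg_avoiding[OF A(1) finX w] tot unfolding g_def by (simp add: algebra_simps)
    moreover have g: "uniform_on A (Suc s) g"
      unfolding g_def by (rule uniform_avoiding[OF w])
    ultimately obtain x where x: "x \<in> A" "\<alpha> / 2 * D \<le> deg A g {x}"
      using exists_heavy_vertex[OF A, of "Suc s" g "\<alpha> / 2 * D"] pos by auto
    have g_zero: "deg A g Y = 0" if "p \<in> X" "p \<subseteq> Y" for p Y
      unfolding g_def using that by (rule deg_avoiding_eq_0)
    have g_le: "deg A g Y \<le> deg A w Y" for Y
      unfolding g_def by (rule deg_avoiding_le[OF w])
    \<comment> \<open>The question must concern a vertex not yet deleted, otherwise a negative
      answer would not lower the measure.\<close>
    have xR: "x \<notin> R"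
    proof
      assume "x \<in> R"
      then have "deg A g {x} = 0"
        by (intro g_zero[of "{x}"]) (auto simp: X_def)
      then show False
        using x pos by (smt (verit) mult_pos_pos half_gt_zero)
    qed
    \<comment> \<open>The link is taken in \<open>g\<close> and not in \<open>w\<close>, so that
      saturated vertices and pairs gain nothing from it.\<close>
    define w2 where "w2 = (\<lambda>S. w' S + link x g S)"
    have w2_deg: "deg A w2 Y = deg A w' Y + deg A (link x g) Y" for Y
      unfolding w2_def by (rule deg_add)
    have pair_le: "deg A g Y \<le> \<rho> * D" if "{x, u} \<subseteq> Y" "u \<in> A" "u \<noteq> x" for u Y
    proof -
      have "deg A g Y \<le> deg A w {x, u}"
        using g_le[of Y] deg_mono[OF A(1) w subset_refl that(1)] by linarith
      also have "{x, u} \<in> nsets A 2"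
        using that x by (auto simp: nsets_def)
      then have "deg A w {x, u} \<le> \<rho> * D"
        using dw by (auto simp: degrees_le_def)
      finally show ?thesis .
    qed
    have "uniform_on A s w2"
      unfolding w2_def by (intro uniform_add w' uniform_link A g x)
    \<comment> \<open>Saturation is noticed only after a threshold is reached. The last link before
      that adds at most \<rho> D, the bound for a pair in \<open>w\<close>, which explains the extra
      \<rho> D in both bounds of the invariant.\<close>
    moreover have "degrees_le A w2 (K * \<tau> * D + \<rho> * D) (2 * \<rho> * D)"
      unfolding degrees_le_def
    proof (intro conjI ballI)
      fix u assume u: "u \<in> A"
      have old: "deg A w' {u} \<le> K * \<tau> * D + \<rho> * D"
        using w'(2) u by (auto simp: degrees_le_def)
      consider "u = x" | "u \<noteq> x" "u \<in> U" | "u \<noteq> x" "u \<notin> U"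
        by blast
      then show "deg A w2 {u} \<le> K * \<tau> * D + \<rho> * D"
      proof cases
        case 1
        then show ?thesis
          using old by (simp add: w2_deg deg_link_in)
      next
        case 2
        then have "deg A g {x, u} = 0"
          by (intro g_zero[of "{u}"]) (auto simp: X_def)
        then show ?thesis
          using old 2 by (simp add: w2_deg deg_link A x)
      next
        case 3
        then have "deg A w' {u} \<le> K * \<tau> * D"
          using u by (auto simp: U_def)
        then show ?thesis
          using pair_le[of u "{x, u}"] 3 u by (simp add: w2_deg deg_link A x)
      qed
    next
      fix p assume p: "p \<in> nsets A 2"
      have old: "deg A w' p \<le> 2 * \<rho> * D"
        using w'(2) p by (auto simp: degrees_le_def)
      consider "x \<in> p" | "x \<notin> p" "p \<in> P" | "x \<notin> p" "p \<notin> P"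
        by blast
      then show "deg A w2 p \<le> 2 * \<rho> * D"
      proof cases
        case 1
        then show ?thesis
          using old by (simp add: w2_deg deg_link_in)
      next
        case 2
        then have "deg A g (insert x p) = 0"
          by (intro g_zero[of p]) (auto simp: X_def)
        then show ?thesis
          using old 2 by (simp add: w2_deg deg_link A x)
      next
        case 3
        then have "deg A w' p \<le> \<rho> * D"
          using p by (auto simp: P_def)
        moreover obtain u where "u \<in> p"
          using p by (force simp: nsets_def)
        then have "deg A g (insert x p) \<le> \<rho> * D"
          using p 3 by (intro pair_le[of u]) (auto simp: nsets_def)
        ultimately show ?thesis
          using 3 by (simp add: w2_deg deg_link A x)
      qed
    qed
    \<comment> \<open>The link has weight \<open>deg A g {x}\<close>, which lies between \<alpha> D
      / 2 by the choice of \<open>x\<close> and D by the degree bound.\<close>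
    moreover have "deg A w2 {} \<le> real (q - (j - 1)) * D"
      "real (q - (j - 1)) * (\<alpha> / 2 * D) \<le> deg A w2 {}"
    proof -
      have eq: "real (q - (j - 1)) = real (q - j) + 1"
        using 3 j by (simp add: of_nat_diff)
      have "deg A w2 {} = deg A w' {} + deg A g {x}"
        by (simp add: w2_deg deg_link A x)
      moreover have "deg A g {x} \<le> D"
        using g_le[of "{x}"] dw x by (force simp: degrees_le_def)
      ultimately show "deg A w2 {} \<le> real (q - (j - 1)) * D"
        "real (q - (j - 1)) * (\<alpha> / 2 * D) \<le> deg A w2 {}"
        using w'(3,4) x(2) unfolding eq by (simp_all add: distrib_right)
    qed
    ultimately have picked: "has_containers A (\<lambda>I. I \<inter> R = {} \<and> edge_free w I \<and> edge_free w2 I) Q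
        ((card (A - R) + 1) ^ (j - 1) * B)"
      using 3 R j by (intro less.hyps) auto
    have eq: "A - insert x R = (A - R) - {x}"
      by auto
    have cardx: "card (A - R) = Suc (card (A - insert x R))"
      unfolding eq using x xR A by (intro card.remove) auto
    then have unpicked: "has_containers A (\<lambda>I. I \<inter> insert x R = {} \<and> edge_free w I \<and> edge_free w' I) Q
        ((card (A - insert x R) + 1) ^ j * B)"
      using R j w' x by (intro less.hyps) auto
    show ?thesis
    proof (rule has_containers_split[OF unpicked picked])
      fix I assume "I \<subseteq> A" and I: "I \<inter> R = {} \<and> edge_free w I \<and> edge_free w' I"
      \<comment> \<open>If \<open>x\<close> lies in \<open>I\<close>, then \<open>insert x S\<close>
        is also a subset of \<open>I\<close>, so \<open>I\<close> is independent in the link as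
        well.\<close>
      have "edge_free w2 I" if "x \<in> I"
        unfolding edge_free_def
      proof (intro allI impI)
        fix S assume "S \<subseteq> I"
        then have "w' S = 0" "w (insert x S) = 0"
          using I that by (auto simp: edge_free_def)
        then show "w2 S = 0"
          by (simp add: w2_def link_def g_def avoiding_def)
      qed
      then show "(I \<inter> insert x R = {} \<and> edge_free w I \<and> edge_free w' I) \<or>
          (I \<inter> R = {} \<and> edge_free w I \<and> edge_free w2 I)"
        using I by blast
    next
      let ?m = "card (A - insert x R)"
      obtain i where i: "j = Suc i"
        using 3 gr0_conv_Suc by blast
      \<comment> \<open>The recursion for the number of leaves: a negative answer leaves
        \<open>?m\<close> candidates and \<open>j\<close> positive answers, a positive one
        \<open>?m + 1\<close> candidates and \<open>j - 1\<close> answers.\<close>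
      have "(?m + 1) ^ j + (?m + 2) ^ i \<le> (?m + 1) * (?m + 2) ^ i + (?m + 2) ^ i"
        unfolding i by (simp add: mult_le_mono power_mono del: add_2_eq_Suc' mult_Suc)
      also have "\<dots> = (?m + 2) ^ j"
        by (simp add: i algebra_simps)
      finally have "((?m + 1) ^ j + (?m + 2) ^ i) * B \<le> (?m + 2) ^ j * B"
        by (rule mult_right_mono) simp
      then show "(?m + 1) ^ j * B + (card (A - R) + 1) ^ (j - 1) * B \<le> (card (A - R) + 1) ^ j * B"
        unfolding cardx i by (simp add: algebra_simps)
    qed
  qed
qed

section \<open>Induction on the uniformity\<close>

lemma degrees_le_mono:
  assumes "degrees_le A w d1 d2" "d1 \<le> d1'" "d2 \<le> d2'"
  shows "degrees_le A w d1' d2'"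
  using assms unfolding degrees_le_def by (meson order_trans)

lemma degrees_le_subset:
  assumes "degrees_le A w d1 d2" "finite A" "uniform_on A r w" "C \<subseteq> A"
  shows "degrees_le C w d1 d2"
proof -
  have "deg C w Y \<le> deg A w Y" for Y
    using deg_mono[OF assms(2-4) subset_refl] .
  moreover have "nsets C 2 \<subseteq> nsets A 2"
    using assms(4) by (rule nsets_mono)
  ultimately show ?thesis
    using assms(1,4) unfolding degrees_le_def by (meson order_trans subsetD)
qed

text \<open>An independent set avoids every vertex of nonzero degree. Since degrees are at most
  \<open>D\<close>, there are at least \<alpha> v such vertices, and removing them all gives a
  single container.\<close>

lemma containers_1_uniform:
  assumes A: "finite A" and w: "uniform_on A 1 w" and dw: "degrees_le A w D d2"
    and tot: "\<alpha> * v * D \<le> deg A w {}" and D: "0 < D"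
  shows "has_containers A (edge_free w) (\<lambda>C. real (card C) \<le> real (card A) - \<alpha> * v) 1"
proof -
  define U where "U = {u \<in> A. deg A w {u} \<noteq> 0}"
  have U: "U \<subseteq> A" "finite U"
    using A by (auto simp: U_def)
  have "\<alpha> * v * D \<le> (\<Sum>u\<in>A. deg A w {u})"
    using tot sum_deg_vertices[OF A w] by simp
  also have "\<dots> = (\<Sum>u\<in>U. deg A w {u})"
    using A by (intro sum.mono_neutral_right) (auto simp: U_def)
  also have "\<dots> \<le> real (card U) * D"
    using dw U by (intro sum_bounded_above) (auto simp: degrees_le_def)
  finally have "\<alpha> * v \<le> real (card U)"
    using D by simp
  moreover have "real (card (A - U)) = real (card A) - real (card U)"
    using U A card_mono[OF A U(1)] by (simp add: card_Diff_subset of_nat_diff)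
  moreover have "I \<subseteq> A - U" if I: "I \<subseteq> A" "edge_free w I" for I
  proof
    fix u assume u: "u \<in> I"
    have "w S = 0" if S: "S \<subseteq> A" "{u} \<subseteq> S" for S
    proof (rule ccontr)
      assume "w S \<noteq> 0"
      moreover from this have "card S = 1"
        using w S by (auto simp: uniform_on_def)
      then have "S = {u}"
        using S by (auto simp: card_1_singleton_iff)
      ultimately show False
        using I u by (auto simp: edge_free_def)
    qed
    then have "deg A w {u} = 0"
      unfolding deg_def by (intro sum.neutral) auto
    then show "u \<in> A - U"
      using u I by (auto simp: U_def)
  qed
  ultimately show ?thesis
    by (intro has_containers_single[of "A - U"]) auto
qed

text \<open>Passing to links lowers vertex degrees by a factor of order \<tau> but keeps pair
  degrees of order \<rho> D, so the ratio \<rho> grows by about 1 / \<tau> per level. With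
  \<open>s\<close> levels above the 1-uniform case, \<rho> \<le> \<tau>^s suffices. The scale
  \<open>v\<close> is separate from \<open>card A\<close>, so it can stay fixed while
  \<open>A\<close> shrinks.\<close>

lemma container_lemma:
  assumes "\<alpha> > 0"
  shows "\<exists>\<beta>>0. \<exists>\<tau>\<^sub>0>0. \<forall>(A :: 'a set) w v D \<rho> \<tau> q. finite A \<longrightarrow> real (card A) \<le> v \<longrightarrow>
    uniform_on A (Suc s) w \<longrightarrow> degrees_le A w D (\<rho> * D) \<longrightarrow> \<alpha> * v * D \<le> deg A w {} \<longrightarrow>
    0 < v \<longrightarrow> 0 < D \<longrightarrow> 0 < \<rho> \<longrightarrow> 0 < \<tau> \<longrightarrow> \<tau> \<le> \<tau>\<^sub>0 \<longrightarrow> \<rho> \<le> \<tau> ^ s \<longrightarrow>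
    \<tau> * v \<le> real q \<longrightarrow> real q \<le> 2 * \<tau> * v \<longrightarrow>
    has_containers A (edge_free w) (\<lambda>C. real (card C) \<le> real (card A) - \<beta> * v)
      (((card A + 1) ^ q) ^ s)"
  using assms
proof (induction s arbitrary: \<alpha>)
  case 0
  show ?case
  proof (rule exI[of _ \<alpha>], intro exI[of _ "1 :: real"] conjI allI impI, goal_cases)
    case (3 A w v D \<rho> \<tau> q)
    then show ?case
      using containers_1_uniform[of A w D "\<rho> * D" \<alpha> v] by simp
  qed (use 0 in auto)
next
  case (Suc s)
  \<comment> \<open>The summand 1 ensures \<open>K \<ge> 1\<close>, the quotient the condition on
    \<open>K * \<alpha>\<close> for few saturated vertices.\<close>
  define K where "K = 16 * real (Suc (Suc s)) / \<alpha> + 1"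
  have K: "K \<ge> 1" "16 * real (Suc (Suc s)) \<le> K * \<alpha>"
    using Suc.prems by (auto simp: K_def field_simps)
  \<comment> \<open>The density of the collected links: total weight at least \<tau> v \<alpha> D /
    2 against the degree bound 2 K \<tau> D.\<close>
  have "\<alpha> / (4 * K) > 0"
    using Suc.prems K by auto
  from Suc.IH[OF this] obtain \<beta>' \<tau>' where IH: "\<beta>' > 0" "\<tau>' > 0" and
    IH': "\<And>(A :: 'a set) w v D \<rho> \<tau> q. finite A \<Longrightarrow> real (card A) \<le> v \<Longrightarrow>
    uniform_on A (Suc s) w \<Longrightarrow> degrees_le A w D (\<rho> * D) \<Longrightarrow> \<alpha> / (4 * K) * v * D \<le> deg A w {} \<Longrightarrow>
    0 < v \<Longrightarrow> 0 < D \<Longrightarrow> 0 < \<rho> \<Longrightarrow> 0 < \<tau> \<Longrightarrow> \<tau> \<le> \<tau>' \<Longrightarrow> \<rho> \<le> \<tau> ^ s \<Longrightarrow>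
    \<tau> * v \<le> real q \<Longrightarrow> real q \<le> 2 * \<tau> * v \<Longrightarrow>
    has_containers A (edge_free w) (\<lambda>C. real (card C) \<le> real (card A) - \<beta>' * v)
      (((card A + 1) ^ q) ^ s)"
    by metis
  \<comment> \<open>The bound \<alpha> / 8 keeps the weight lost through deleted vertices small;
    \<open>\<beta>'\<close> is what the induction hypothesis removes.\<close>
  define \<beta> where "\<beta> = min (\<alpha> / 8) \<beta>'"
  define \<tau>\<^sub>0 where "\<tau>\<^sub>0 = min (min \<tau>' 1) (\<alpha> / (16 * (real (Suc (Suc s)))\<^sup>2))"
  have pos: "\<beta> > 0" "\<tau>\<^sub>0 > 0"
    using Suc.prems IH by (auto simp: \<beta>_def \<tau>\<^sub>0_def)
  show ?case
  proof (rule exI[of _ \<beta>], intro exI[of _ \<tau>\<^sub>0] conjI allI impI, goal_cases)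
    case (3 A w v D \<rho> \<tau> q)
    note A = 3(1,2) and w = 3(3) and dw = 3(4) and tot = 3(5) and pos = 3(6-9)
    have \<tau>: "\<tau> \<le> \<tau>'" "\<tau> \<le> 1" "\<tau> \<le> \<alpha> / (16 * (real (Suc (Suc s)))\<^sup>2)"
      using 3(10) by (auto simp: \<tau>\<^sub>0_def)
    then have small: "16 * (real (Suc (Suc s)))\<^sup>2 * \<tau> \<le> \<alpha>"
      by (simp add: field_simps)
    have "\<tau> ^ Suc s \<le> \<tau>"
      using power_le_one[of \<tau> s] \<tau> pos mult_left_mono[of "\<tau> ^ s" 1 \<tau>] by simp
    moreover have "\<tau> \<le> K * \<tau>"
      using K pos by simp
    ultimately have "\<rho> \<le> K * \<tau>"
      using 3(11) by linarith
    then have \<rho>D: "K * \<tau> * D + \<rho> * D \<le> 2 * K * \<tau> * D"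
      using mult_right_mono[of \<rho> "K * \<tau>" D] pos by simp
    have "\<rho> \<le> \<tau> ^ s * \<tau>"
      using 3(11) by (simp add: mult.commute)
    also have "\<dots> \<le> \<tau> ^ s * (K * \<tau>)"
      using \<open>\<tau> \<le> K * \<tau>\<close> pos by (intro mult_left_mono) auto
    finally have \<rho>': "\<rho> / (K * \<tau>) \<le> \<tau> ^ s"
      using K pos by (simp add: divide_le_eq)
    define Q where "Q = (\<lambda>C :: 'a set. real (card C) \<le> real (card A) - \<beta> * v)"
    have links: "has_containers A (edge_free w') Q (((card A + 1) ^ q) ^ s)"
      if w': "uniform_on A (Suc s) w'" "degrees_le A w' (K * \<tau> * D + \<rho> * D) (2 * \<rho> * D)"
        "real q * (\<alpha> / 2 * D) \<le> deg A w' {}" for w'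
    proof -
      have "has_containers A (edge_free w') (\<lambda>C. real (card C) \<le> real (card A) - \<beta>' * v)
          (((card A + 1) ^ q) ^ s)"
      \<comment> \<open>With degree bound 2 K \<tau> D, the pair bound 2 \<rho> D corresponds to the
        ratio \<rho> / (K \<tau>).\<close>
      proof (rule IH'[OF A w'(1), of "2 * K * \<tau> * D" "\<rho> / (K * \<tau>)" \<tau>])
        show "degrees_le A w' (2 * K * \<tau> * D) (\<rho> / (K * \<tau>) * (2 * K * \<tau> * D))"
          using w'(2) \<rho>D by (rule degrees_le_mono) (use K pos in simp)
        have "\<alpha> / (4 * K) * v * (2 * K * \<tau> * D) = \<tau> * v * (\<alpha> / 2 * D)"
          using K by (simp add: field_simps)
        also have "\<dots> \<le> real q * (\<alpha> / 2 * D)"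
          using 3(12) Suc.prems pos by (intro mult_right_mono) auto
        finally show "\<alpha> / (4 * K) * v * (2 * K * \<tau> * D) \<le> deg A w' {}"
          using w'(3) by linarith
      qed (use K pos \<rho>' \<tau> 3 in auto)
      moreover have "\<beta> * v \<le> \<beta>' * v"
        using pos by (intro mult_right_mono) (auto simp: \<beta>_def)
      ultimately show ?thesis
        by (elim has_containers_mono) (auto simp: Q_def)
    qed
    have zero: "uniform_on A (Suc s) (\<lambda>_. 0)" "\<And>Y. deg A (\<lambda>_. 0) Y = 0"
      by (auto simp: uniform_on_def deg_def)
    \<comment> \<open>The root of the tree: nothing deleted, no link collected, all \<open>q\<close>
      positive answers available.\<close>
    have "has_containers A (\<lambda>I. I \<inter> {} = {} \<and> edge_free w I \<and> edge_free (\<lambda>_. 0) I) Q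
        ((card (A - {}) + 1) ^ q * ((card A + 1) ^ q) ^ s)"
    proof (rule container_process[OF A w dw tot])
      show "\<beta> \<le> \<alpha> / 8"
        by (simp add: \<beta>_def)
      show "degrees_le A (\<lambda>_. 0) (K * \<tau> * D + \<rho> * D) (2 * \<rho> * D)"
        using K pos by (simp add: degrees_le_def zero)
    qed (use K pos small 3(13) Suc.prems links zero in \<open>auto simp: Q_def\<close>)
    then show ?case
      unfolding Q_def by (rule has_containers_mono) (auto simp: edge_free_def)
  qed (use pos in auto)
qed

section \<open>Iteration down to sparse containers\<close>

text \<open>While a container still carries weight \<alpha> v D it can be refined, and each
  refinement removes \<beta> v vertices. As \<open>v\<close> and \<open>D\<close> stay fixed, about
  1 / \<beta> rounds suffice.\<close>

lemma sparse_containers: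
  assumes "\<alpha> > 0"
  shows "\<exists>m. \<exists>\<tau>\<^sub>0>0. \<forall>(A :: 'a set) w v D \<rho> \<tau> q. finite A \<longrightarrow> real (card A) \<le> v \<longrightarrow>
    uniform_on A (Suc s) w \<longrightarrow> degrees_le A w D (\<rho> * D) \<longrightarrow>
    0 < v \<longrightarrow> 0 < D \<longrightarrow> 0 < \<rho> \<longrightarrow> 0 < \<tau> \<longrightarrow> \<tau> \<le> \<tau>\<^sub>0 \<longrightarrow> \<rho> \<le> \<tau> ^ s \<longrightarrow>
    \<tau> * v \<le> real q \<longrightarrow> real q \<le> 2 * \<tau> * v \<longrightarrow>
    has_containers A (edge_free w) (\<lambda>C. deg C w {} < \<alpha> * v * D) ((((card A + 1) ^ q) ^ s) ^ m)"
proof -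
  obtain \<beta> \<tau>\<^sub>0 where pos': "\<beta> > 0" "\<tau>\<^sub>0 > 0" and
    *: "\<And>(A :: 'a set) w v D \<rho> \<tau> q. finite A \<Longrightarrow> real (card A) \<le> v \<Longrightarrow>
    uniform_on A (Suc s) w \<Longrightarrow> degrees_le A w D (\<rho> * D) \<Longrightarrow> \<alpha> * v * D \<le> deg A w {} \<Longrightarrow>
    0 < v \<Longrightarrow> 0 < D \<Longrightarrow> 0 < \<rho> \<Longrightarrow> 0 < \<tau> \<Longrightarrow> \<tau> \<le> \<tau>\<^sub>0 \<Longrightarrow> \<rho> \<le> \<tau> ^ s \<Longrightarrow>
    \<tau> * v \<le> real q \<Longrightarrow> real q \<le> 2 * \<tau> * v \<Longrightarrow>
    has_containers A (edge_free w) (\<lambda>C. real (card C) \<le> real (card A) - \<beta> * v)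
      (((card A + 1) ^ q) ^ s)"
    using container_lemma[OF assms, of s] by metis
  show ?thesis
  proof (intro exI[of _ "nat \<lceil>1 / \<beta>\<rceil>"] exI[of _ \<tau>\<^sub>0] conjI allI impI, goal_cases)
    case (2 A w v D \<rho> \<tau> q)
    define B where "B = ((card A + 1) ^ q) ^ s"
    \<comment> \<open>Here \<open>i\<close> bounds the rounds still needed, measured by the number
      of vertices left in \<open>C\<close>.\<close>
    have *: "has_containers C (edge_free w) (\<lambda>C. deg C w {} < \<alpha> * v * D) (B ^ i)"
      if "C \<subseteq> A" "real (card C) \<le> real i * (\<beta> * v)" for i C
      using that
    proof (induction i arbitrary: C)
      case 0
      \<comment> \<open>The uniformity is positive, so the empty set carries no weight.\<close>
      then have "C = {}"
        using 2(1) finite_subset by fastforce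
      then have "deg C w {} = 0"
        using 2(3) by (auto simp: deg_def uniform_on_def)
      then show ?case
        using 2 assms by (intro has_containers_single[of C]) auto
    next
      case (Suc i)
      show ?case
      proof (cases "deg C w {} < \<alpha> * v * D")
        case True
        then show ?thesis
          by (intro has_containers_single[of C]) (auto simp: B_def)
      next
        case False
        have C: "finite C" "card C \<le> card A"
          using Suc.prems 2(1) finite_subset card_mono by blast+
        have "has_containers C (edge_free w) (\<lambda>C'. real (card C') \<le> real (card C) - \<beta> * v)
            (((card C + 1) ^ q) ^ s)"
        proof (rule *)
          show "uniform_on C (Suc s) w"
            using 2(3) Suc.prems(1) by (auto simp: uniform_on_def)
          show "degrees_le C w D (\<rho> * D)"
            by (rule degrees_le_subset[OF 2(4,1,3) Suc.prems(1)])
          show "real (card C) \<le> v"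
            using C 2(2) by linarith
        qed (use C 2 False in auto)
        moreover have "((card C + 1) ^ q) ^ s \<le> B"
          unfolding B_def using C by (intro power_mono) auto
        ultimately have "has_containers C (edge_free w) (\<lambda>C'. real (card C') \<le> real i * (\<beta> * v)) B"
          using Suc.prems(2) by (elim has_containers_mono) (auto simp: algebra_simps)
        then show ?thesis
          unfolding power_Suc using Suc.prems(1)
          by (elim has_containers_bind, intro Suc.IH) auto
      qed
    qed
    have "1 \<le> real (nat \<lceil>1 / \<beta>\<rceil>) * \<beta>"
      using mult_right_mono[OF real_nat_ceiling_ge[of "1 / \<beta>"], of \<beta>] pos' by simp
    then have "v \<le> real (nat \<lceil>1 / \<beta>\<rceil>) * (\<beta> * v)"
      using mult_right_mono[of 1 _ v] 2(5) by (fastforce simp: mult.assoc)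
    then show ?case
      using *[of A "nat \<lceil>1 / \<beta>\<rceil>"] 2(2) unfolding B_def by simp
  qed (use pos' in auto)
qed

section \<open>The hypergraph of coloured copies\<close>

definition coloured_copy :: "nat \<Rightarrow> nat set \<Rightarrow> (nat set \<Rightarrow> nat) \<Rightarrow> (nat set \<times> nat) set" where
  "coloured_copy N A c = (\<lambda>e. (elem A ` e, c e)) ` edges N"

definition copies :: "nat \<Rightarrow> nat \<Rightarrow> (nat set \<Rightarrow> nat) set \<Rightarrow> (nat set \<times> nat) set set" where
  "copies N n \<F> = (\<lambda>(A, c). coloured_copy N A c) ` (nsets {1..n} N \<times> \<F>)"

text \<open>Some edge may be left without colours, so the result need not be a template.\<close>

definition graph_template :: "nat \<Rightarrow> (nat set \<times> nat) set \<Rightarrow> nat set \<Rightarrow> nat set" where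
  "graph_template n C = (\<lambda>e\<in>edges n. {i. (e, i) \<in> C})"

lemma bij_betw_elem:
  assumes "finite A"
  shows "bij_betw (elem A) {1..card A} A"
proof -
  have "bij_betw ((!) (sorted_list_of_set A)) {..<card A} A"
    using assms by (intro bij_betw_nth) auto
  moreover have "bij_betw (\<lambda>i. i - 1) {1..card A} {..<card A}"
    by (rule bij_betw_byWitness[of _ Suc]) auto
  ultimately have "bij_betw ((!) (sorted_list_of_set A) \<circ> (\<lambda>i. i - 1)) {1..card A} A"
    by (rule bij_betw_trans[rotated])
  then show ?thesis
    by (simp add: elem_def comp_def cong: bij_betw_cong)
qed

lemma inj_on_elem_image:
  assumes "A \<in> nsets {1..n} N"
  shows "inj_on ((`) (elem A)) (edges N)"
proof -
  have "inj_on (elem A) {1..N}"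
    using bij_betw_elem[of A] assms by (auto simp: nsets_def bij_betw_def)
  then have "inj_on ((`) (elem A)) (Pow {1..N})"
    by (rule inj_on_image_Pow)
  then show ?thesis
    by (rule inj_on_subset) (auto simp: nsets_def)
qed

lemma elem_image_edge:
  assumes "A \<in> nsets {1..n} N" "e \<in> edges N"
  shows "elem A ` e \<in> edges n" "elem A ` e \<subseteq> A"
proof -
  have b: "bij_betw (elem A) {1..N} A"
    using bij_betw_elem[of A] assms by (auto simp: nsets_def)
  have e: "e \<subseteq> {1..N}" "finite e" "card e = 2"
    using assms by (auto simp: nsets_def)
  show sub: "elem A ` e \<subseteq> A"
    using b e by (auto simp: bij_betw_def)
  have "card (elem A ` e) = 2"
    using b e by (metis bij_betw_def card_image inj_on_subset)
  then show "elem A ` e \<in> edges n"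
    using sub assms e by (auto simp: nsets_def)
qed

lemma card_coloured_copy:
  assumes "A \<in> nsets {1..n} N"
  shows "card (coloured_copy N A c) = N choose 2"
proof -
  have "inj_on (\<lambda>e. (elem A ` e, c e)) (edges N)"
    using inj_on_elem_image[OF assms] by (auto simp: inj_on_def)
  then show ?thesis
    unfolding coloured_copy_def by (simp add: card_image card_nsets)
qed

text \<open>For \<open>N \<ge> 2\<close> every vertex lies on an edge, so a copy determines its
  vertex set.\<close>

lemma vertices_coloured_copy:
  assumes A: "A \<in> nsets {1..n} N" and N: "N \<ge> 2"
  shows "\<Union>(fst ` coloured_copy N A c) = A"
proof
  show "\<Union>(fst ` coloured_copy N A c) \<subseteq> A"
    using elem_image_edge[OF A] by (auto simp: coloured_copy_def)
  show "A \<subseteq> \<Union>(fst ` coloured_copy N A c)"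
  proof
    fix a assume "a \<in> A"
    moreover have "bij_betw (elem A) {1..N} A"
      using bij_betw_elem[of A] A by (auto simp: nsets_def)
    then have "A = elem A ` {1..N}"
      by (simp add: bij_betw_imp_surj_on)
    ultimately obtain i where i: "i \<in> {1..N}" "a = elem A i"
      by blast
    define j where "j = (if i = 1 then 2 else 1 :: nat)"
    have "{i, j} \<in> edges N"
      using i N by (auto simp: nsets_def j_def)
    then have "(elem A ` {i, j}, c {i, j}) \<in> coloured_copy N A c"
      unfolding coloured_copy_def by blast
    then show "a \<in> \<Union>(fst ` coloured_copy N A c)"
      using i by (force intro: rev_bexI)
  qed
qed

lemma coloured_copy_functional:
  assumes "A \<in> nsets {1..n} N" "(e, i) \<in> coloured_copy N A c" "(e, j) \<in> coloured_copy N A c"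
  shows "i = j"
  using assms(2,3) inj_on_elem_image[OF assms(1)] by (auto simp: coloured_copy_def inj_on_def)

text \<open>Removing \<open>Z\<close> is injective and leaves \<open>N - card Z\<close> elements to
  choose.\<close>

lemma card_supersets_le:
  assumes "Z \<subseteq> {1..n}" "card Z \<le> N"
  shows "card {A \<in> nsets {1..n} N. Z \<subseteq> A} \<le> n ^ (N - card Z)"
proof -
  have finZ: "finite Z"
    using assms(1) finite_subset by blast
  have "card {A \<in> nsets {1..n} N. Z \<subseteq> A} \<le> card (nsets {1..n} (N - card Z))"
  proof (rule card_inj_on_le[of "\<lambda>A. A - Z"])
    show "inj_on (\<lambda>A. A - Z) {A \<in> nsets {1..n} N. Z \<subseteq> A}"
      by (auto simp: inj_on_def)
    show "(\<lambda>A. A - Z) ` {A \<in> nsets {1..n} N. Z \<subseteq> A} \<subseteq> nsets {1..n} (N - card Z)"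
      using finZ by (auto simp: nsets_def card_Diff_subset)
  qed (simp add: finite_imp_finite_nsets)
  also have "\<dots> = n choose (N - card Z)"
    by (simp add: card_nsets)
  also have "\<dots> \<le> n ^ (N - card Z)"
    by (cases "N - card Z \<le> n") (auto intro: binomial_le_pow simp: binomial_eq_0)
  finally show ?thesis .
qed

lemma card_copies_containing_le:
  assumes F: "finite \<F>" and N: "N \<ge> 2" and Z: "\<Union>(fst ` Y) = Z"
  shows "card {S \<in> copies N n \<F>. Y \<subseteq> S} \<le> card {A \<in> nsets {1..n} N. Z \<subseteq> A} * card \<F>"
proof -
  let ?X = "{A \<in> nsets {1..n} N. Z \<subseteq> A}"
  have fin: "finite (?X \<times> \<F>)"
    using F finite_imp_finite_nsets[of "{1..n}" N] by simp
  have "{S \<in> copies N n \<F>. Y \<subseteq> S} \<subseteq> (\<lambda>(A, c). coloured_copy N A c) ` (?X \<times> \<F>)"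
  proof
    fix S assume "S \<in> {S \<in> copies N n \<F>. Y \<subseteq> S}"
    then obtain A c where A: "A \<in> nsets {1..n} N" "c \<in> \<F>" "S = coloured_copy N A c" "Y \<subseteq> S"
      by (auto simp: copies_def)
    then have "Z \<subseteq> A"
      using vertices_coloured_copy[OF A(1) N, of c] Z by blast
    then show "S \<in> (\<lambda>(A, c). coloured_copy N A c) ` (?X \<times> \<F>)"
      using A by auto
  qed
  then have "card {S \<in> copies N n \<F>. Y \<subseteq> S} \<le> card (?X \<times> \<F>)"
    by (rule surj_card_le[OF fin])
  then show ?thesis
    by (simp add: card_cartesian_product)
qed

lemma finite_colourings: "finite (colourings k n)"
  unfolding colourings_def by (intro finite_PiE) (auto intro: finite_imp_finite_nsets)

lemma card_colourings: "card (colourings k n) = k ^ (n choose 2)"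
  unfolding colourings_def by (subst card_PiE) (auto simp: card_nsets finite_imp_finite_nsets)

lemma uniform_copies: "uniform_on A (N choose 2) (indicator (copies N n \<F>))"
  unfolding uniform_on_def
  by (auto simp: copies_def card_coloured_copy indicator_def split: if_splits)

lemma deg_indicator:
  assumes "finite A"
  shows "deg A (indicator E) Y = real (card {S \<in> E. S \<subseteq> A \<and> Y \<subseteq> S})"
proof -
  have "deg A (indicator E) Y = (\<Sum>S | S \<subseteq> A \<and> Y \<subseteq> S. if S \<in> E then 1 else 0)"
    unfolding deg_def by (intro sum.cong) (auto simp: indicator_def)
  also have "\<dots> = (\<Sum>S\<in>{S \<in> {S. S \<subseteq> A \<and> Y \<subseteq> S}. S \<in> E}. 1)"
    using assms by (intro sum.inter_filter[symmetric]) auto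
  also have "{S \<in> {S. S \<subseteq> A \<and> Y \<subseteq> S}. S \<in> E} = {S \<in> E. S \<subseteq> A \<and> Y \<subseteq> S}"
    by auto
  finally show ?thesis
    by simp
qed

text \<open>One edge fixes two vertices of a copy; two different edges fix at least three, which
  saves a factor \<open>n\<close>; and no copy gives two colours to one edge. \<open>D\<close>
  counts all colourings of \<open>K_N\<close>, so it does not depend on \<F>.\<close>

lemma degrees_copies:
  assumes F: "\<F> \<subseteq> colourings k N" and N: "N \<ge> 2" and n: "n \<ge> 1"
    and D: "D = real (k ^ (N choose 2)) * real n ^ (N - 2)"
  shows "degrees_le (edges n \<times> {1..k}) (indicator (copies N n \<F>)) D (1 / real n * D)"
proof -
  let ?V = "edges n \<times> {1..k}"
  have fin: "finite ?V"
    by (auto intro: finite_imp_finite_nsets)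
  have finF: "finite \<F>" and cF: "card \<F> \<le> k ^ (N choose 2)"
    using F finite_colourings finite_subset card_mono card_colourings by metis+
  have finC: "finite (copies N n \<F>)"
    unfolding copies_def using finF by (auto intro: finite_imp_finite_nsets)
  have deg_le: "deg ?V (indicator (copies N n \<F>)) Y
      \<le> real (k ^ (N choose 2)) * real (card {A \<in> nsets {1..n} N. \<Union>(fst ` Y) \<subseteq> A})" for Y
  proof -
    have "card {S \<in> copies N n \<F>. S \<subseteq> ?V \<and> Y \<subseteq> S} \<le> card {S \<in> copies N n \<F>. Y \<subseteq> S}"
      using finC by (intro card_mono) auto
    also have "\<dots> \<le> card {A \<in> nsets {1..n} N. \<Union>(fst ` Y) \<subseteq> A} * card \<F>"
      by (rule card_copies_containing_le[OF finF N refl])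
    also have "\<dots> \<le> k ^ (N choose 2) * card {A \<in> nsets {1..n} N. \<Union>(fst ` Y) \<subseteq> A}"
      using cF by (simp add: mult.commute)
    finally have "real (card {S \<in> copies N n \<F>. S \<subseteq> ?V \<and> Y \<subseteq> S})
        \<le> real (k ^ (N choose 2) * card {A \<in> nsets {1..n} N. \<Union>(fst ` Y) \<subseteq> A})"
      by (rule of_nat_mono)
    then show ?thesis
      unfolding deg_indicator[OF fin] by simp
  qed
  have Dnn: "0 \<le> 1 / real n * D"
    unfolding D by simp
  show ?thesis
    unfolding degrees_le_def
  proof (intro conjI ballI)
    fix u assume "u \<in> ?V"
    then obtain e i where u: "u = (e, i)" "e \<in> edges n"
      by auto
    then have "card e = 2" "e \<subseteq> {1..n}"
      by (auto simp: nsets_def)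
    then have "card {A \<in> nsets {1..n} N. e \<subseteq> A} \<le> n ^ (N - 2)"
      using card_supersets_le[of e n N] N by simp
    then have "real (card {A \<in> nsets {1..n} N. e \<subseteq> A}) \<le> real n ^ (N - 2)"
      by (metis of_nat_le_iff of_nat_power)
    then show "deg ?V (indicator (copies N n \<F>)) {u} \<le> D"
      using deg_le[of "{u}"] unfolding D u by (auto elim!: order_trans intro!: mult_left_mono)
  next
    fix p assume "p \<in> nsets ?V 2"
    then have sub: "p \<subseteq> ?V" and "card p = 2"
      unfolding nsets_def[of ?V] by blast+
    then obtain u u' where p: "p = {u, u'}" "u \<noteq> u'"
      unfolding card_2_iff by blast
    with sub obtain e i e' i' where u: "u = (e, i)" "u' = (e', i')" "e \<in> edges n" "e' \<in> edges n"
      by auto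
    show "deg ?V (indicator (copies N n \<F>)) p \<le> 1 / real n * D"
    proof (cases "e = e'")
      case True
      have "\<not> p \<subseteq> S" if S: "S \<in> copies N n \<F>" for S
      proof
        assume "p \<subseteq> S"
        moreover obtain A c where "A \<in> nsets {1..n} N" "S = coloured_copy N A c"
          using S by (auto simp: copies_def)
        ultimately have "i = i'"
          using coloured_copy_functional[of A n N e i c i'] unfolding p u True by simp
        then show False
          using p u True by simp
      qed
      then have "{S \<in> copies N n \<F>. S \<subseteq> ?V \<and> p \<subseteq> S} = {}"
        by blast
      then have "deg ?V (indicator (copies N n \<F>)) p = 0"
        unfolding deg_indicator[OF fin] by (simp only: card.empty)
      then show ?thesis
        using Dnn by simp
    next
      case False
      let ?Z = "e \<union> e'"
      have e: "card e = 2" "card e' = 2" "finite e" "finite e'" "e \<subseteq> {1..n}" "e' \<subseteq> {1..n}"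
        using u by (auto simp: nsets_def)
      have "\<not> e' \<subseteq> e"
        using False e by (metis card_subset_eq)
      then have "e \<subset> ?Z"
        by auto
      then have Z: "card ?Z \<ge> 3"
        using psubset_card_mono[of ?Z e] e by simp
      have le: "deg ?V (indicator (copies N n \<F>)) p
          \<le> real (k ^ (N choose 2)) * real (card {A \<in> nsets {1..n} N. ?Z \<subseteq> A})"
        using deg_le[of p] unfolding p u by simp
      show ?thesis
      \<comment> \<open>For \<open>N = 2\<close> two different edges always span more than
        \<open>N\<close> vertices. Then no copy contains both, and the truncated exponent
        \<open>N - 3\<close> is avoided.\<close>
      proof (cases "card ?Z \<le> N")
        case True
        have "card {A \<in> nsets {1..n} N. ?Z \<subseteq> A} \<le> n ^ (N - card ?Z)"
          using card_supersets_le[of ?Z n N] True e by simp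
        also have "\<dots> \<le> n ^ (N - 3)"
          using n Z by (intro power_increasing) auto
        finally have "real (card {A \<in> nsets {1..n} N. ?Z \<subseteq> A}) \<le> real n ^ (N - 3)"
          by (metis of_nat_le_iff of_nat_power)
        also have "N - 2 = Suc (N - 3)"
          using Z True by simp
        then have "real n ^ (N - 3) = 1 / real n * real n ^ (N - 2)"
          using n by simp
        finally have "real (k ^ (N choose 2)) * real (card {A \<in> nsets {1..n} N. ?Z \<subseteq> A})
            \<le> real (k ^ (N choose 2)) * (1 / real n * real n ^ (N - 2))"
          by (intro mult_left_mono) auto
        then show ?thesis
          using le unfolding D by (simp add: mult.left_commute)
      next
        case False
        have "card ?Z \<le> N" if "A \<in> nsets {1..n} N" "?Z \<subseteq> A" for A
          using that card_mono[of A ?Z] by (auto simp: nsets_def)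
        then have "{A \<in> nsets {1..n} N. ?Z \<subseteq> A} = {}"
          using False by blast
        then have "deg ?V (indicator (copies N n \<F>)) p \<le> 0"
          using le by (simp only: card.empty)
        then show ?thesis
          using Dnn by linarith
      qed
    qed
  qed
qed

section \<open>From containers to templates\<close>

text \<open>A copy of \<open>d\<close> inside the graph of \<open>c\<close> forces
  \<open>restr c A = d\<close>; both are \<open>undefined\<close> off the edges.\<close>

lemma edge_free_colouring:
  assumes F: "\<F> \<subseteq> colourings k N" and c: "c \<in> Forb k N \<F> n"
  shows "edge_free (indicator (copies N n \<F>)) ((\<lambda>e. (e, c e)) ` edges n)"
  unfolding edge_free_def
proof (intro allI impI)
  fix S assume S: "S \<subseteq> (\<lambda>e. (e, c e)) ` edges n"
  have "S \<notin> copies N n \<F>"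
  proof
    assume "S \<in> copies N n \<F>"
    then obtain A d where A: "A \<in> nsets {1..n} N" "d \<in> \<F>" "S = coloured_copy N A d"
      unfolding copies_def by blast
    have "d \<in> colourings k N"
      using A(2) F by blast
    then have d: "d e = undefined" if "e \<notin> edges N" for e
      using that unfolding colourings_def by (rule PiE_arb)
    have agree: "c (elem A ` e) = d e" if "e \<in> edges N" for e
    proof -
      have "(elem A ` e, d e) \<in> S"
        using that unfolding A(3) coloured_copy_def by (rule imageI)
      then have "(elem A ` e, d e) \<in> (\<lambda>e. (e, c e)) ` edges n"
        by (rule subsetD[OF S])
      then show ?thesis
        by (simp add: image_iff)
    qed
    have "card A = N"
      using A(1) unfolding nsets_def by blast
    then have "restr c A = d"
      by (intro ext) (simp add: restr_def agree d)
    moreover have "restr c A \<notin> \<F>"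
      using A(1) c by (simp add: Forb_def)
    ultimately show False
      using A(2) by simp
  qed
  then show "indicator (copies N n \<F>) S = (0 :: real)"
    by simp
qed

lemma below_graph_template:
  assumes "A \<in> nsets {1..n} N"
  shows "below N c (restr (graph_template n C) A) \<longleftrightarrow> coloured_copy N A c \<subseteq> C"
proof -
  have N: "card A = N"
    using assms unfolding nsets_def by blast
  have "c e \<in> restr (graph_template n C) A e \<longleftrightarrow> (elem A ` e, c e) \<in> C" if "e \<in> edges N" for e
    using that elem_image_edge(1)[OF assms that] by (simp add: restr_def graph_template_def N)
  then show ?thesis
    unfolding below_def coloured_copy_def image_subset_iff by (rule ball_cong[OF refl])
qed

text \<open>Each such \<open>A\<close> is the vertex set of a copy inside \<open>C\<close>, so these
  sets are no more numerous than the copies.\<close>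

lemma card_copies_below_graph_template:
  assumes F: "\<F> \<subseteq> colourings k N" and N: "N \<ge> 2" and C: "finite C"
  shows "real (card {A \<in> nsets {1..n} N. \<exists>c\<in>\<F>. below N c (restr (graph_template n C) A)})
    \<le> deg C (indicator (copies N n \<F>)) {}"
proof -
  have "{A \<in> nsets {1..n} N. \<exists>c\<in>\<F>. below N c (restr (graph_template n C) A)}
      \<subseteq> (\<lambda>S. \<Union>(fst ` S)) ` {S \<in> copies N n \<F>. S \<subseteq> C \<and> {} \<subseteq> S}"
  proof
    fix A assume "A \<in> {A \<in> nsets {1..n} N. \<exists>c\<in>\<F>. below N c (restr (graph_template n C) A)}"
    then obtain c where A: "A \<in> nsets {1..n} N" "c \<in> \<F>" "coloured_copy N A c \<subseteq> C"
      by (auto simp: below_graph_template)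
    then have "coloured_copy N A c \<in> {S \<in> copies N n \<F>. S \<subseteq> C \<and> {} \<subseteq> S}"
      by (auto simp: copies_def)
    then show "A \<in> (\<lambda>S. \<Union>(fst ` S)) ` {S \<in> copies N n \<F>. S \<subseteq> C \<and> {} \<subseteq> S}"
      by (rule rev_image_eqI) (simp only: vertices_coloured_copy[OF A(1) N])
  qed
  moreover have "finite {S \<in> copies N n \<F>. S \<subseteq> C \<and> {} \<subseteq> S}"
    by (rule finite_subset[of _ "Pow C"]) (use C in auto)
  ultimately have "card {A \<in> nsets {1..n} N. \<exists>c\<in>\<F>. below N c (restr (graph_template n C) A)}
      \<le> card {S \<in> copies N n \<F>. S \<subseteq> C \<and> {} \<subseteq> S}"
    by (rule surj_card_le[rotated])
  then show ?thesis
    unfolding deg_indicator[OF C] by simp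
qed

lemma graph_template_realisation:
  assumes C: "C \<subseteq> edges n \<times> {1..k}" and c: "c \<in> colourings k n" "(\<lambda>e. (e, c e)) ` edges n \<subseteq> C"
  shows "graph_template n C \<in> templates k n" "c \<in> realisations k n (graph_template n C)"
proof -
  have *: "c e \<in> graph_template n C e" if "e \<in> edges n" for e
    using c that by (auto simp: graph_template_def)
  show "graph_template n C \<in> templates k n"
    unfolding templates_def
  proof (rule PiE_I)
    fix e assume e: "e \<in> edges n"
    then have "graph_template n C e \<subseteq> {1..k}"
      using C by (auto simp: graph_template_def)
    then show "graph_template n C e \<in> Pow {1..k} - {{}}"
      using *[OF e] by blast
  qed (simp add: graph_template_def)
  show "c \<in> realisations k n (graph_template n C)"
    using c * by (simp add: realisations_def below_def)
qed

lemma templates_from_containers: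
  assumes F: "\<F> \<subseteq> colourings k N" and N: "N \<ge> 2"
    and cont: "has_containers (edges n \<times> {1..k}) (edge_free (indicator (copies N n \<F>)))
      (\<lambda>C. deg C (indicator (copies N n \<F>)) {} \<le> d) B"
  shows "\<exists>\<T>\<subseteq>templates k n. container_family k n \<T> (Forb k N \<F> n) \<and>
    (\<forall>t\<in>\<T>. real (card {A \<in> nsets {1..n} N. \<exists>c\<in>\<F>. below N c (restr t A)}) \<le> d) \<and>
    card \<T> \<le> B"
proof -
  let ?V = "edges n \<times> {1..k}"
  have fin: "finite ?V"
    by (auto intro: finite_imp_finite_nsets)
  obtain \<C> where \<C>: "finite \<C>" "card \<C> \<le> B"
    "\<forall>C\<in>\<C>. C \<subseteq> ?V \<and> deg C (indicator (copies N n \<F>)) {} \<le> d"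
    "\<forall>I\<subseteq>?V. edge_free (indicator (copies N n \<F>)) I \<longrightarrow> (\<exists>C\<in>\<C>. I \<subseteq> C)"
    using cont unfolding has_containers_def by blast
  \<comment> \<open>The intersection drops containers that leave an edge without colours; they cover
    no colouring.\<close>
  define \<T> where "\<T> = graph_template n ` \<C> \<inter> templates k n"
  have "\<exists>t\<in>\<T>. c \<in> realisations k n t" if c: "c \<in> Forb k N \<F> n" for c
  proof -
    have col: "c \<in> colourings k n"
      using c by (simp add: Forb_def)
    then have "(\<lambda>e. (e, c e)) ` edges n \<subseteq> ?V"
      by (auto simp: colourings_def)
    then obtain C where "C \<in> \<C>" "(\<lambda>e. (e, c e)) ` edges n \<subseteq> C"
      using \<C>(4)[rule_format, OF _ edge_free_colouring[OF F c]] by blast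
    moreover from this have "C \<subseteq> ?V"
      using \<C>(3) by simp
    ultimately show ?thesis
      using graph_template_realisation[OF _ col] unfolding \<T>_def by (meson IntI imageI)
  qed
  then have "container_family k n \<T> (Forb k N \<F> n)"
    unfolding container_family_def \<T>_def by blast
  moreover have "real (card {A \<in> nsets {1..n} N. \<exists>c\<in>\<F>. below N c (restr t A)}) \<le> d"
    if t: "t \<in> \<T>" for t
  proof -
    obtain C where C: "C \<in> \<C>" "t = graph_template n C"
      using t by (auto simp: \<T>_def)
    then have "finite C"
      using \<C>(3) fin finite_subset by blast
    then show ?thesis
      using card_copies_below_graph_template[OF F N, of C n] C \<C>(3) by fastforce
  qed
  moreover have "card \<T> \<le> B"
    using card_mono[of "graph_template n ` \<C>" \<T>] card_image_le[OF \<C>(1), of "graph_template n"] \<C>(1,2)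
    unfolding \<T>_def by fastforce
  ultimately show ?thesis
    unfolding \<T>_def by blast
qed

section \<open>Size of the family and final assembly\<close>

text \<open>For \<open>s = 0\<close> the junk value \<open>2 / \<delta> = 0\<close> does no harm, because of the factor \<open>s\<close> in \<open>C\<close>.\<close>

lemma log_container_count_le:
  fixes s k n m q M :: nat
  assumes k: "k \<ge> 2" and n: "n \<ge> 2" and M: "M \<le> k * n\<^sup>2"
    and q: "real q \<le> 2 * real n powr (- 1 / real (Suc s)) * (real k * (real n)\<^sup>2)"
    and C: "C = 8 * real k * real s * real m * (ln (2 * real k) + 2 / \<delta>) / ln (real k)"
    and \<delta>: "\<delta> = 1 / real (Suc s) - 1 / (2 * real (Suc s) - 1)"
  shows "real q * real s * real m * log (real k) (real (M + 1))
    \<le> C * real n powr (- (1 / (2 * real (Suc s) - 1))) * real (n choose 2)"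
proof (cases "s = 0")
  case True
  then show ?thesis
    by (simp add: C)
next
  case False
  \<comment> \<open>With r = s + 1 > 1, 2 r - 1 exceeds r. The gap \<delta> between the two
    exponents pays for the logarithm, as ln n is at most n^\<delta> / \<delta>.\<close>
  have "1 / (2 * real (Suc s) - 1) < 1 / real (Suc s)"
    using False by (intro divide_strict_left_mono mult_pos_pos) auto
  then have \<delta>_pos: "\<delta> > 0"
    by (simp add: \<delta>)
  have npos: "real n powr x > 0" for x
    using n by simp
  have lnk: "ln (real k) > 0"
    using k by simp
  have one: "1 \<le> real n powr \<delta>"
    using n \<delta>_pos by (intro ge_one_powr_ge_zero) auto
  have "real (M + 1) \<le> 2 * real k * (real n)\<^sup>2"
  proof -
    have "1 \<le> k * n\<^sup>2"
      using k n by (simp add: Suc_le_eq)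
    then have "M + 1 \<le> 2 * k * n\<^sup>2"
      using M by linarith
    then have "real (M + 1) \<le> real (2 * k * n\<^sup>2)"
      by (rule of_nat_mono)
    then show ?thesis
      by simp
  qed
  then have "ln (real (M + 1)) \<le> ln (2 * real k * (real n)\<^sup>2)"
    by (subst ln_le_cancel_iff) (use k n in auto)
  also have "\<dots> = ln (2 * real k) + 2 * ln (real n)"
    using k n by (simp add: ln_mult ln_realpow)
  also have "\<dots> \<le> ln (2 * real k) * real n powr \<delta> + 2 * (real n powr \<delta> / \<delta>)"
  proof (intro add_mono mult_left_mono)
    show "ln (2 * real k) \<le> ln (2 * real k) * real n powr \<delta>"
      using one k by (simp add: mult_le_cancel_left1)
    show "ln (real n) \<le> real n powr \<delta> / \<delta>"
      using n \<delta>_pos by (intro ln_powr_bound) auto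
  qed auto
  also have "\<dots> = (ln (2 * real k) + 2 / \<delta>) * real n powr \<delta>"
    by (simp add: algebra_simps)
  finally have lnM: "ln (real (M + 1)) \<le> (ln (2 * real k) + 2 / \<delta>) * real n powr \<delta>" .
  define c where "c = (ln (2 * real k) + 2 / \<delta>) / ln (real k)"
  have c: "c \<ge> 0"
    using k \<delta>_pos lnk by (auto simp: c_def)
  have logM: "log (real k) (real (M + 1)) \<le> c * real n powr \<delta>"
    using divide_right_mono[OF lnM less_imp_le[OF lnk]] by (simp add: log_def c_def)
  have "real n powr (- 1 / real (Suc s)) * real n powr \<delta> = real n powr (- 1 / real (Suc s) + \<delta>)"
    by (rule powr_add[symmetric])
  also have "- 1 / real (Suc s) + \<delta> = - (1 / (2 * real (Suc s) - 1))"
    unfolding \<delta> by (simp del: of_nat_Suc)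
  finally have powr: "real n powr (- 1 / real (Suc s)) * real n powr \<delta>
      = real n powr (- (1 / (2 * real (Suc s) - 1)))" .
  \<comment> \<open>This factor 4 and the factor 2 in the bound on \<open>q\<close> make up the 8 in
    \<open>C\<close>.\<close>
  have "n * n \<le> 4 * (n choose 2)"
  proof -
    have "n * n \<le> n * (2 * (n - 1))"
      using n by (intro mult_le_mono2) auto
    also have "\<dots> = 2 * (n * (n - 1))"
      by (rule mult.left_commute)
    also have "even (n * (n - 1))"
      by (cases "even n") auto
    then have "n * (n - 1) = 2 * (n choose 2)"
      unfolding choose_two by (rule dvd_mult_div_cancel[symmetric])
    finally show ?thesis
      by simp
  qed
  then have n2: "(real n)\<^sup>2 \<le> 4 * real (n choose 2)"
    unfolding power2_eq_square by (metis of_nat_le_iff of_nat_mult of_nat_numeral)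
  have "real q * real s * real m * log (real k) (real (M + 1)) = (real s * real m) * (real q * log (real k) (real (M + 1)))"
    by simp
  also have "\<dots> \<le> (real s * real m) * ((2 * real n powr (- 1 / real (Suc s)) * (real k * (real n)\<^sup>2)) * (c * real n powr \<delta>))"
    using q logM k by (intro mult_left_mono mult_mono) auto
  also have "\<dots> = 2 * real k * real s * real m * c * (real n powr (- 1 / real (Suc s)) * real n powr \<delta>) * (real n)\<^sup>2"
    by (simp add: mult_ac)
  also have "\<dots> \<le> 2 * real k * real s * real m * c * (real n powr (- 1 / real (Suc s)) * real n powr \<delta>) * (4 * real (n choose 2))"
    using n2 c by (intro mult_left_mono) auto
  also have "\<dots> = C * real n powr (- (1 / (2 * real (Suc s) - 1))) * real (n choose 2)"
    unfolding powr C c_def by simp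
  finally show ?thesis .
qed

text \<open>Without edges the everywhere undefined function is the only colouring, so it lies in
  \<F>; every restriction to an \<open>N\<close>-set equals it.\<close>

lemma Forb_eq_empty:
  assumes N: "N \<le> 1" and F: "\<F> \<subseteq> colourings k N" "\<F> \<noteq> {}" and n: "n \<ge> 1"
  shows "Forb k N \<F> n = {}"
proof -
  have E: "edges N = {}"
    using N by (auto simp: nsets_def dest: card_mono[rotated])
  then have F': "(\<lambda>_. undefined) \<in> \<F>"
    using F by (auto simp: colourings_def)
  have "nsets {1..n} N \<noteq> {}"
    using N n by (simp add: nsets_eq_empty_iff)
  then obtain A where A: "A \<in> nsets {1..n} N"
    by blast
  then have "card A = N"
    unfolding nsets_def by blast
  then have "restr c A = (\<lambda>_. undefined)" for c :: "nat set \<Rightarrow> nat"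
    by (intro ext) (simp only: restr_def restrict_def E empty_iff if_False)
  then show ?thesis
    using A F' unfolding Forb_def by fastforce
qed

theorem theorem2p6:
  fixes k N :: nat and \<epsilon> :: real
  assumes "k \<ge> 2" and "\<epsilon> > 0"
  shows "\<exists>C\<^sub>0 n\<^sub>0 :: real. C\<^sub>0 > 0 \<and> n\<^sub>0 > 0 \<and>
    (\<forall>\<F> \<subseteq> colourings k N. \<F> \<noteq> {} \<longrightarrow>
      (\<forall>n::nat. real n \<ge> n\<^sub>0 \<longrightarrow>
        (\<exists>\<T> \<subseteq> templates k n.
          container_family k n \<T> (Forb k N \<F> n) \<and>
          (\<forall>t\<in>\<T>. real (card {A \<in> nsets {1..n} N. \<exists>c\<in>\<F>. below N c (restr t A)})
              \<le> \<epsilon> * real (n choose N)) \<and>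
          elog k (card \<T>)
            \<le> ereal (C\<^sub>0 * real n powr (- (1 / (2 * real (N choose 2) - 1)))
                      * real (n choose 2)))))"
proof (cases "N \<ge> 2")
  case False
  show ?thesis
  proof (rule exI[of _ 1], rule exI[of _ 1], intro conjI allI impI)
    fix \<F> :: "(nat set \<Rightarrow> nat) set" and n :: nat
    assume "\<F> \<subseteq> colourings k N" "\<F> \<noteq> {}" "1 \<le> real n"
    then have "Forb k N \<F> n = {}"
      using False by (intro Forb_eq_empty) auto
    then show "\<exists>\<T> \<subseteq> templates k n.
          container_family k n \<T> (Forb k N \<F> n) \<and>
          (\<forall>t\<in>\<T>. real (card {A \<in> nsets {1..n} N. \<exists>c\<in>\<F>. below N c (restr t A)})
              \<le> \<epsilon> * real (n choose N)) \<and>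
          elog k (card \<T>)
            \<le> ereal (1 * real n powr (- (1 / (2 * real (N choose 2) - 1)))
                      * real (n choose 2))"
      \<comment> \<open>The empty family covers the empty set, and its logarithm is
        -\<infinity>.\<close>
      by (intro exI[of _ "{}"]) (simp add: container_family_def elog_def)
  qed auto
next
  case True
  note N = True
  have "N choose 2 > 0"
    using N by (simp add: zero_less_binomial)
  then obtain s where s: "N choose 2 = Suc s"
    using gr0_conv_Suc by blast
  define L where "L = k ^ (N choose 2)"
  \<comment> \<open>Chosen so that \<alpha> v D becomes \<epsilon> (n / N)^N, a lower bound for
    \<epsilon> times \<open>n choose N\<close>.\<close>
  define \<alpha> where "\<alpha> = \<epsilon> / (real N ^ N * real k * real L)"
  have \<alpha>: "\<alpha> > 0"
    using assms N by (simp add: \<alpha>_def L_def)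
  obtain m \<tau>\<^sub>0 where \<tau>\<^sub>0: "\<tau>\<^sub>0 > 0" and
    containers: "\<And>(A :: (nat set \<times> nat) set) w v D \<rho> \<tau> q. finite A \<Longrightarrow> real (card A) \<le> v \<Longrightarrow>
    uniform_on A (Suc s) w \<Longrightarrow> degrees_le A w D (\<rho> * D) \<Longrightarrow>
    0 < v \<Longrightarrow> 0 < D \<Longrightarrow> 0 < \<rho> \<Longrightarrow> 0 < \<tau> \<Longrightarrow> \<tau> \<le> \<tau>\<^sub>0 \<Longrightarrow> \<rho> \<le> \<tau> ^ s \<Longrightarrow>
    \<tau> * v \<le> real q \<Longrightarrow> real q \<le> 2 * \<tau> * v \<Longrightarrow>
    has_containers A (edge_free w) (\<lambda>C. deg C w {} < \<alpha> * v * D) ((((card A + 1) ^ q) ^ s) ^ m)"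
    using sparse_containers[OF \<alpha>, of s] by metis
  define \<delta> where "\<delta> = 1 / real (Suc s) - 1 / (2 * real (Suc s) - 1)"
  define C\<^sub>1 where "C\<^sub>1 = 8 * real k * real s * real m * (ln (2 * real k) + 2 / \<delta>) / ln (real k)"
  have "1 / (2 * real (Suc s) - 1) \<le> 1 / real (Suc s)"
    by (intro divide_left_mono mult_pos_pos) auto
  then have "\<delta> \<ge> 0"
    by (simp add: \<delta>_def)
  then have C\<^sub>1: "C\<^sub>1 \<ge> 0"
    using assms(1) by (simp add: C\<^sub>1_def)
  \<comment> \<open>The first entry serves the binomial bound, the second makes \<tau> at most
    \<open>\<tau>\<^sub>0\<close>. Like \<open>m\<close>, both are fixed before \<F> is.\<close>
  define n\<^sub>0 where "n\<^sub>0 = max (real N) (\<tau>\<^sub>0 powr (- real (Suc s)))"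
  show ?thesis
  \<comment> \<open>\<open>C\<^sub>1\<close> vanishes for \<open>s = 0\<close>, hence the added
    1.\<close>
  proof (rule exI[of _ "C\<^sub>1 + 1"], rule exI[of _ n\<^sub>0], intro conjI allI impI)
    show "C\<^sub>1 + 1 > 0" "n\<^sub>0 > 0"
      using C\<^sub>1 N by (auto simp: n\<^sub>0_def)
    fix \<F> :: "(nat set \<Rightarrow> nat) set" and n :: nat
    assume F: "\<F> \<subseteq> colourings k N" and n\<^sub>0: "n\<^sub>0 \<le> real n"
    let ?V = "edges n \<times> {1..k}"
    let ?w = "indicator (copies N n \<F>) :: (nat set \<times> nat) set \<Rightarrow> real"
    have n: "N \<le> n" "2 \<le> n"
      using n\<^sub>0 N by (auto simp: n\<^sub>0_def)
    define v where "v = real k * (real n)\<^sup>2"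
    define D where "D = real (k ^ (N choose 2)) * real n ^ (N - 2)"
    \<comment> \<open>The codegree ratio \<rho> = 1 / n has to be at most \<tau>^s; the exponent 1 /
      (s + 1) achieves this and makes sense for \<open>s = 0\<close> too.\<close>
    define \<tau> where "\<tau> = real n powr (- 1 / real (Suc s))"
    define q where "q = nat \<lceil>\<tau> * v\<rceil>"
    have fin: "finite ?V"
      using finite_imp_finite_nsets[of "{1..n}" 2] by simp
    have cardV: "card ?V \<le> k * n\<^sup>2"
      using binomial_le_pow[of 2 n] n by (simp add: card_cartesian_product card_nsets)
    then have cardV': "real (card ?V) \<le> v"
      unfolding v_def by (metis of_nat_le_iff of_nat_mult of_nat_power)
    have pos: "v > 0" "D > 0" "\<tau> > 0"
      using n assms by (auto simp: v_def D_def \<tau>_def)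
    have "\<tau> \<le> \<tau>\<^sub>0"
    proof -
      have "\<tau>\<^sub>0 powr (- real (Suc s)) \<le> real n"
        using n\<^sub>0 by (simp add: n\<^sub>0_def)
      then have "\<tau> \<le> (\<tau>\<^sub>0 powr (- real (Suc s))) powr (- 1 / real (Suc s))"
        unfolding \<tau>_def using \<tau>\<^sub>0 by (intro powr_mono2') (auto simp del: of_nat_Suc)
      also have "\<dots> = \<tau>\<^sub>0"
        using \<tau>\<^sub>0 by (simp add: powr_powr del: of_nat_Suc)
      finally show ?thesis .
    qed
    have "\<tau> ^ s = real n powr (- (real s / real (Suc s)))"
      using pos n by (simp add: \<tau>_def powr_powr flip: powr_realpow)
    moreover have "real n powr (- 1) \<le> real n powr (- (real s / real (Suc s)))"
      using n by (intro powr_mono) auto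
    ultimately have \<rho>: "1 / real n \<le> \<tau> ^ s"
      using n by (simp add: powr_minus_divide)
    have "real n powr (- 1) \<le> \<tau>"
      unfolding \<tau>_def using n by (intro powr_mono) auto
    then have "1 / real n * v \<le> \<tau> * v"
      using pos n by (intro mult_right_mono) (auto simp: powr_minus_divide)
    moreover have "1 \<le> 1 / real n * v"
      using n assms mult_mono[of 1 "real k" 1 "real n"] by (simp add: v_def power2_eq_square)
    ultimately have "1 \<le> \<tau> * v"
      by linarith
    \<comment> \<open>Rounding up a number that is at least 1 at most doubles it.\<close>
    then have q: "\<tau> * v \<le> real q" "real q \<le> 2 * \<tau> * v"
      unfolding q_def by linarith+
    have "\<alpha> * v * D = \<epsilon> * (real n / real N) ^ N"
    proof -
      have "real n ^ N = (real n)\<^sup>2 * real n ^ (N - 2)"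
        using N by (metis le_add_diff_inverse power_add)
      then show ?thesis
        using assms N by (simp add: \<alpha>_def v_def D_def L_def power_divide)
    qed
    also have "\<dots> \<le> \<epsilon> * real (n choose N)"
      using binomial_ge_n_over_k_pow_k[of N n] n assms by (intro mult_left_mono) auto
    finally have \<epsilon>: "\<alpha> * v * D \<le> \<epsilon> * real (n choose N)" .
    have "uniform_on ?V (Suc s) ?w"
      using uniform_copies[of ?V N n \<F>] s by simp
    moreover have "degrees_le ?V ?w D (1 / real n * D)"
      using n by (intro degrees_copies[OF F N _ D_def]) auto
    ultimately have "has_containers ?V (edge_free ?w) (\<lambda>C. deg C ?w {} < \<alpha> * v * D)
        ((((card ?V + 1) ^ q) ^ s) ^ m)"
      using n by (intro containers[OF fin cardV' _ _ pos(1,2) _ pos(3) \<open>\<tau> \<le> \<tau>\<^sub>0\<close> \<rho> q]) auto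
    then have "has_containers ?V (edge_free ?w) (\<lambda>C. deg C ?w {} \<le> \<epsilon> * real (n choose N))
        ((card ?V + 1) ^ (q * s * m))"
      by (rule has_containers_mono) (use \<epsilon> in \<open>auto simp: power_mult\<close>)
    from templates_from_containers[OF F N this] obtain \<T> where \<T>: "\<T> \<subseteq> templates k n"
      "container_family k n \<T> (Forb k N \<F> n)"
      "\<forall>t\<in>\<T>. real (card {A \<in> nsets {1..n} N. \<exists>c\<in>\<F>. below N c (restr t A)}) \<le> \<epsilon> * real (n choose N)"
      and card: "card \<T> \<le> (card ?V + 1) ^ (q * s * m)"
      by blast
    have "elog k (card \<T>) \<le> ereal ((C\<^sub>1 + 1) * real n powr (- (1 / (2 * real (N choose 2) - 1)))
        * real (n choose 2))"
    proof (cases "card \<T> = 0")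
      case True
      then show ?thesis
        by (simp add: elog_def)
    next
      case False
      have "real (card \<T>) \<le> real (card ?V + 1) ^ (q * s * m)"
        using card by (metis of_nat_le_iff of_nat_power)
      then have "log (real k) (real (card \<T>)) \<le> log (real k) (real (card ?V + 1) ^ (q * s * m))"
        using False assms by (subst log_le_cancel_iff) auto
      also have "\<dots> = real (q * s * m) * log (real k) (real (card ?V + 1))"
        by (rule log_nat_power) simp
      also have "\<dots> = real q * real s * real m * log (real k) (real (card ?V + 1))"
        by simp
      also have "\<dots> \<le> C\<^sub>1 * real n powr (- (1 / (2 * real (Suc s) - 1))) * real (n choose 2)"
        using q(2) by (intro log_container_count_le[OF assms(1) n(2) cardV _ C\<^sub>1_def \<delta>_def])
          (simp only: v_def \<tau>_def)
      also have "\<dots> \<le> (C\<^sub>1 + 1) * real n powr (- (1 / (2 * real (Suc s) - 1))) * real (n choose 2)"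
        by (intro mult_right_mono) auto
      finally show ?thesis
        using False unfolding elog_def s by simp
    qed
    with \<T> show "\<exists>\<T> \<subseteq> templates k n.
          container_family k n \<T> (Forb k N \<F> n) \<and>
          (\<forall>t\<in>\<T>. real (card {A \<in> nsets {1..n} N. \<exists>c\<in>\<F>. below N c (restr t A)})
              \<le> \<epsilon> * real (n choose N)) \<and>
          elog k (card \<T>)
            \<le> ereal ((C\<^sub>1 + 1) * real n powr (- (1 / (2 * real (N choose 2) - 1)))
                      * real (n choose 2))"
      by blast
  qed
qed

end
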